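(* For every integer $n\ge 1$ there exists a finite constant $c_n$, depending only on $n$, such that the following holds. Let $N$ be a positive integer and $a>0$, and consider a motion of $N$ identical hard spheres of radius $a$ and unit mass in the whole space $\mathbb{R}^n$, with elastic, frictionless collisions. Assume that the set of collisions is finite on every band $(0,\tau)\times\mathbb{R}^n$ ($\tau>0$), and that the motion involves only binary collisions. Let $H_\alpha$ ($1\le\alpha\le N$) be the hodograph of the particle $P_\alpha$ in the inertial frame in which the mean velocity vanishes, let $\ell(H_\alpha)$ be its length and $A(H_\alpha)$ the area it sweeps about the origin. Then $$\sum_{\alpha=1}^N\ell(H_\alpha)\le c_nN^2\,\mathbf{v},\qquad \sum_{\alpha=1}^N A(H_\alpha)\le c_nN^2\,\mathbf{v}\,\bar v,$$ where $\bar v$ is the root mean square velocity and $\mathbf{v}$ is the standard deviation of the velocities.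
   Context: Dynamics. The particles $P_\alpha$, $1\le\alpha\le N$, are spheres of radius $a>0$ and mass $1$ in $\mathbb{R}^n$, with centers $y_\alpha(t)$ and velocities $v_\alpha(t)\in\mathbb{R}^n$; distinct centers always satisfy $|y_\alpha-y_\beta|\ge 2a$. The velocity of each particle is constant between its consecutive collisions. A collision between $P_\alpha$ and $P_\beta$ occurs when $|y_\beta-y_\alpha|=2a$ and the velocities $v_\alpha,v_\beta$ before and $v'_\alpha,v'_\beta$ after satisfy $$(v_\beta-v_\alpha)\cdot(y_\beta-y_\alpha)<0,\qquad (v'_\beta-v'_\alpha)\cdot(y_\beta-y_\alpha)>0.$$ At a binary collision: (i) $v'_\alpha+v'_\beta=v_\alpha+v_\beta$; (ii) $v'_\alpha-v_\alpha=v_\beta-v'_\beta$ is parallel to $y_\beta-y_\alpha$; (iii) $|v'_\alpha|^2+|v'_\beta|^2=|v_\alpha|^2+|v_\beta|^2$. "Only binary collisions" means that every collision involves exactly two particles. Constants of the motion: energy $E=\sum_\alpha\frac12|v_\alpha(t)|^2$, mean velocity $w=\frac1N\sum_\alpha v_\alpha(t)$, root mean square velocity $\bar v=\sqrt{2E/N}$, standard deviation $\mathbf{v}=\sqrt{\bar v^2-|w|^2}$. Hodographs. The map $t\mapsto v_\alpha(t)-w$ ($t>0$) is piecewise constant; $H_\alpha$ is the polygonal chain passing through its consecutive values. Denoting by $v,v'$ the velocities of $P_\alpha$ just before and just after a collision it experiences, the length is $\ell(H_\alpha)=\sum|v'-v|$ and the area swept about the origin is $A(H_\alpha)=\sum\frac12|(v-w)\wedge(v'-w)|$,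 the sums running over all the collisions experienced by $P_\alpha$ in times $t>0$. For $x,y\in\mathbb{R}^n$, $|x\wedge y|=\sqrt{|x|^2|y|^2-(x\cdot y)^2}$. *)

theory Defs
  imports "HOL-Analysis.Analysis"
begin

text \<open>
  The particles are the indices \<open>\<alpha> < N\<close>; \<open>y \<alpha> t\<close> is the center of particle \<open>\<alpha>\<close> at time \<open>t > 0\<close>.
  Values at times \<open>t \<le> 0\<close> are irrelevant. Velocities are the one-sided time derivatives of \<open>y \<alpha>\<close>,
  which exist at every \<open>t > 0\<close> for the motions below once the collisions are locally finite.
\<close>

definition vel_before :: "(real \<Rightarrow> real ^ 'n) \<Rightarrow> real \<Rightarrow> real ^ 'n" where
  "vel_before x t = vector_derivative x (at_left t)"

definition vel_after :: "(real \<Rightarrow> real ^ 'n) \<Rightarrow> real \<Rightarrow> real ^ 'n" where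
  "vel_after x t = vector_derivative x (at_right t)"

definition collide :: "real \<Rightarrow> (nat \<Rightarrow> real \<Rightarrow> real ^ 'n) \<Rightarrow> nat \<Rightarrow> nat \<Rightarrow> real \<Rightarrow> bool" where
  "collide a y \<alpha> \<beta> t \<longleftrightarrow>
     norm (y \<beta> t - y \<alpha> t) = 2 * a \<and>
     (vel_before (y \<beta>) t - vel_before (y \<alpha>) t) \<bullet> (y \<beta> t - y \<alpha> t) < 0 \<and>
     (vel_after (y \<beta>) t - vel_after (y \<alpha>) t) \<bullet> (y \<beta> t - y \<alpha> t) > 0"

definition collision_times ::
    "nat \<Rightarrow> real \<Rightarrow> (nat \<Rightarrow> real \<Rightarrow> real ^ 'n) \<Rightarrow> nat \<Rightarrow> real set" where
  "collision_times N a y \<alpha> = {t. t > 0 \<and> (\<exists>\<beta><N. collide a y \<alpha> \<beta> t)}"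

text \<open>
  The collision of \<open>\<alpha>\<close> and \<open>\<beta>\<close> at time \<open>t\<close> involves no third particle. Collisions of disjoint
  pairs at the same instant are distinct collisions and are allowed.
\<close>

definition binary_collision ::
    "nat \<Rightarrow> real \<Rightarrow> (nat \<Rightarrow> real \<Rightarrow> real ^ 'n) \<Rightarrow> nat \<Rightarrow> nat \<Rightarrow> real \<Rightarrow> bool" where
  "binary_collision N a y \<alpha> \<beta> t \<longleftrightarrow>
     collide a y \<alpha> \<beta> t \<and>
     (\<forall>\<gamma><N. collide a y \<alpha> \<gamma> t \<longrightarrow> \<gamma> = \<beta>) \<and>
     (\<forall>\<gamma><N. collide a y \<beta> \<gamma> t \<longrightarrow> \<gamma> = \<alpha>)"

definition elastic_law :: "(nat \<Rightarrow> real \<Rightarrow> real ^ 'n) \<Rightarrow> nat \<Rightarrow> nat \<Rightarrow> real \<Rightarrow> bool" where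
  "elastic_law y \<alpha> \<beta> t \<longleftrightarrow>
     vel_after (y \<alpha>) t + vel_after (y \<beta>) t = vel_before (y \<alpha>) t + vel_before (y \<beta>) t \<and>
     (\<exists>k. vel_after (y \<alpha>) t - vel_before (y \<alpha>) t = k *\<^sub>R (y \<beta> t - y \<alpha> t) \<and>
          vel_before (y \<beta>) t - vel_after (y \<beta>) t = k *\<^sub>R (y \<beta> t - y \<alpha> t)) \<and>
     (norm (vel_after (y \<alpha>) t))\<^sup>2 + (norm (vel_after (y \<beta>) t))\<^sup>2 =
       (norm (vel_before (y \<alpha>) t))\<^sup>2 + (norm (vel_before (y \<beta>) t))\<^sup>2"

definition hard_sphere_motion ::
    "nat \<Rightarrow> real \<Rightarrow> (nat \<Rightarrow> real \<Rightarrow> real ^ 'n) \<Rightarrow> bool" where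
  "hard_sphere_motion N a y \<longleftrightarrow>
     (\<forall>\<alpha><N. continuous_on {0<..} (y \<alpha>)) \<and>
     (\<forall>\<alpha><N. \<forall>\<beta><N. \<alpha> \<noteq> \<beta> \<longrightarrow> (\<forall>t>0. norm (y \<alpha> t - y \<beta> t) \<ge> 2 * a)) \<and>
     (\<forall>\<alpha><N. \<forall>s\<ge>0. \<forall>u>s. {s<..<u} \<inter> collision_times N a y \<alpha> = {} \<longrightarrow>
        (\<exists>V. \<forall>t\<in>{s<..<u}. (y \<alpha> has_vector_derivative V) (at t))) \<and>
     (\<forall>\<alpha><N. \<forall>\<beta><N. \<forall>t>0. binary_collision N a y \<alpha> \<beta> t \<longrightarrow> elastic_law y \<alpha> \<beta> t)"

definition locally_finite_collisions ::
    "nat \<Rightarrow> real \<Rightarrow> (nat \<Rightarrow> real \<Rightarrow> real ^ 'n) \<Rightarrow> bool" where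
  "locally_finite_collisions N a y \<longleftrightarrow>
     (\<forall>\<tau>>0. finite {(\<alpha>, \<beta>, t). \<alpha> < N \<and> \<beta> < N \<and> 0 < t \<and> t < \<tau> \<and> collide a y \<alpha> \<beta> t})"

definition only_binary_collisions ::
    "nat \<Rightarrow> real \<Rightarrow> (nat \<Rightarrow> real \<Rightarrow> real ^ 'n) \<Rightarrow> bool" where
  "only_binary_collisions N a y \<longleftrightarrow>
     (\<forall>\<alpha><N. \<forall>\<beta><N. \<forall>t>0. collide a y \<alpha> \<beta> t \<longrightarrow> binary_collision N a y \<alpha> \<beta> t)"

text \<open>
  The next four quantities do not depend on \<open>t > 0\<close> for the motions considered. At a collision
  time they are evaluated with the velocities just after the collision.
\<close>

definition energy :: "nat \<Rightarrow> (nat \<Rightarrow> real \<Rightarrow> real ^ 'n) \<Rightarrow> real \<Rightarrow> real" where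
  "energy N y t = (\<Sum>\<alpha><N. (norm (vel_after (y \<alpha>) t))\<^sup>2 / 2)"

definition mean_velocity :: "nat \<Rightarrow> (nat \<Rightarrow> real \<Rightarrow> real ^ 'n) \<Rightarrow> real \<Rightarrow> real ^ 'n" where
  "mean_velocity N y t = (1 / real N) *\<^sub>R (\<Sum>\<alpha><N. vel_after (y \<alpha>) t)"

definition rms_velocity :: "nat \<Rightarrow> (nat \<Rightarrow> real \<Rightarrow> real ^ 'n) \<Rightarrow> real \<Rightarrow> real" where
  "rms_velocity N y t = sqrt (2 * energy N y t / real N)"

definition std_velocity :: "nat \<Rightarrow> (nat \<Rightarrow> real \<Rightarrow> real ^ 'n) \<Rightarrow> real \<Rightarrow> real" where
  "std_velocity N y t = sqrt ((rms_velocity N y t)\<^sup>2 - (norm (mean_velocity N y t))\<^sup>2)"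

definition wedge_norm :: "real ^ 'n \<Rightarrow> real ^ 'n \<Rightarrow> real" where
  "wedge_norm x y = sqrt ((norm x)\<^sup>2 * (norm y)\<^sup>2 - (x \<bullet> y)\<^sup>2)"

text \<open>
  A particle may a priori undergo infinitely many collisions in \<open>t > 0\<close>, so length and area are
  taken in \<open>ennreal\<close>, where the sums are always meaningful (a real-valued \<open>infsum\<close> would be \<open>0\<close> for
  a divergent sum). The sums run over times: with binary collisions a particle experiences at most
  one collision at each time.
\<close>

definition hodograph_length ::
    "nat \<Rightarrow> real \<Rightarrow> (nat \<Rightarrow> real \<Rightarrow> real ^ 'n) \<Rightarrow> nat \<Rightarrow> ennreal" where
  "hodograph_length N a y \<alpha> =
     (\<Sum>\<^sub>\<infinity>t\<in>collision_times N a y \<alpha>.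
        ennreal (norm (vel_after (y \<alpha>) t - vel_before (y \<alpha>) t)))"

text \<open>Area swept about the origin in the inertial frame moving with velocity \<open>w\<close>.\<close>

definition hodograph_area ::
    "nat \<Rightarrow> real \<Rightarrow> (nat \<Rightarrow> real \<Rightarrow> real ^ 'n) \<Rightarrow> real ^ 'n \<Rightarrow> nat \<Rightarrow> ennreal" where
  "hodograph_area N a y w \<alpha> =
     (\<Sum>\<^sub>\<infinity>t\<in>collision_times N a y \<alpha>.
        ennreal (wedge_norm (vel_before (y \<alpha>) t - w) (vel_after (y \<alpha>) t - w) / 2))"

end

theory Submission
  imports Defs
begin

text \<open>
  Read the trajectories in space-time, together with one rod per collision that joins the two
  centers and carries the exchanged momentum, as a framework of bars in equilibrium (a
  divergence-free positive symmetric tensor). Projecting to a coordinate plane keeps the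
  equilibrium. In the plane, sweep the framework by a line and let \<open>Q\<close> be the derivative of
  \<open>\<Sum> m\<^sub>e m\<^sub>f \<bar>h\<^sub>f - h\<^sub>e\<bar>\<close>, where \<open>h\<^sub>e\<close> is the height at which bar \<open>e\<close> meets the line
  and \<open>m\<^sub>e\<close> the component of its force across the line. Then \<open>Q\<close> is nondecreasing: between the
  nodes by convexity of the absolute value, and at a node it jumps at least by the area spanned by the
  forces that meet there, which is \<open>\<bar>u \<and> u'\<bar>\<close> for a particle deflected from \<open>u\<close> to \<open>u'\<close>. Far
  away only the \<open>2 N\<close> free rays remain, so the total variation of \<open>Q\<close> is controlled by the
  velocities before the first and after the last collision. The coordinate planes containing the
  time axis give the length, the spatial ones give the area, and the conservation laws with the
  Cauchy-Schwarz inequality bound the contribution of the rays.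
\<close>

section \<open>Planar frameworks in equilibrium\<close>

text \<open>
  \<open>dplus u s\<close> and \<open>dminus u s\<close> are the right and left derivatives of \<open>\<bar>u + s * d\<bar>\<close> at \<open>d = 0\<close>.
\<close>

definition dplus :: "real \<Rightarrow> real \<Rightarrow> real" where
  "dplus u s = (if u = 0 then \<bar>s\<bar> else sgn u * s)"

definition dminus :: "real \<Rightarrow> real \<Rightarrow> real" where
  "dminus u s = (if u = 0 then - \<bar>s\<bar> else sgn u * s)"

lemma abs_dplus_le: "\<bar>dplus u s\<bar> \<le> \<bar>s\<bar>"
  by (auto simp: dplus_def sgn_if)

lemma abs_dminus_le: "\<bar>dminus u s\<bar> \<le> \<bar>s\<bar>"
  by (auto simp: dminus_def sgn_if)

text \<open>Convexity: \<open>\<bar>u + s * d\<bar>\<close> is convex in \<open>d\<close>, so its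
  right derivative at one point is at most its left derivative at any later point.\<close>

lemma dplus_le_dminus:
  assumes "d > 0"
  shows "dplus u s \<le> dminus (u + s * d) s"
proof -
  consider "s > 0" | "s = 0" | "s < 0" by linarith
  then show ?thesis
  proof cases
    case 1
    then have "s * d > 0" using assms by simp
    then show ?thesis using 1 by (auto simp: dplus_def dminus_def sgn_if)
  next
    case 2
    then show ?thesis by (auto simp: dplus_def dminus_def sgn_if)
  next
    case 3
    then have "s * d < 0" using assms by (simp add: mult_neg_pos)
    then show ?thesis using 3 by (auto simp: dplus_def dminus_def sgn_if)
  qed
qed

text \<open>
  The bar \<open>e\<close> joins \<open>L e\<close> to \<open>R e\<close>, on its right, and carries the force vector \<open>m e *\<^sub>R (1, s e)\<close>;
  \<open>E\<close> thus has no bar parallel to the sweeping line. Nodes outside the strip \<open>A < x < B\<close> need not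
  be in equilibrium.
\<close>

locale planar_stress =
  fixes E :: "'e set" and V :: "'v set" and L R :: "'e \<Rightarrow> 'v"
    and x y :: "'v \<Rightarrow> real" and m s :: "'e \<Rightarrow> real" and A B :: real
  assumes finite_E: "finite E" and finite_V: "finite V"
    and L_in: "\<And>e. e \<in> E \<Longrightarrow> L e \<in> V" and R_in: "\<And>e. e \<in> E \<Longrightarrow> R e \<in> V"
    and L_less_R: "\<And>e. e \<in> E \<Longrightarrow> x (L e) < x (R e)"
    and m_nonneg: "\<And>e. e \<in> E \<Longrightarrow> 0 \<le> m e"
    and slope: "\<And>e. e \<in> E \<Longrightarrow> y (R e) = y (L e) + s e * (x (R e) - x (L e))"
    and balance_m: "\<And>v. v \<in> V \<Longrightarrow> A < x v \<Longrightarrow> x v < B \<Longrightarrow>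
      (\<Sum>e | e \<in> E \<and> L e = v. m e) = (\<Sum>e | e \<in> E \<and> R e = v. m e)"
    and balance_ms: "\<And>v. v \<in> V \<Longrightarrow> A < x v \<Longrightarrow> x v < B \<Longrightarrow>
      (\<Sum>e | e \<in> E \<and> L e = v. m e * s e) = (\<Sum>e | e \<in> E \<and> R e = v. m e * s e)"
begin

section \<open>The sweep functional and its monotonicity\<close>

definition h :: "'e \<Rightarrow> real \<Rightarrow> real" where
  "h e c = y (L e) + s e * (c - x (L e))"

text \<open>The bars crossed by the sweeping line immediately to the right of \<open>c\<close>;
  \<open>before\<close> is the mirror image. The half-open conditions differ only for bars that
  start or end at abscissa \<open>c\<close>.\<close>

definition after :: "real \<Rightarrow> 'e set" where
  "after c = {e \<in> E. x (L e) \<le> c \<and> c < x (R e)}"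

definition before :: "real \<Rightarrow> 'e set" where
  "before c = {e \<in> E. x (L e) < c \<and> c \<le> x (R e)}"

text \<open>Area of the parallelogram spanned by the force vectors of the two bars.\<close>

definition wedge :: "'e \<Rightarrow> 'e \<Rightarrow> real" where
  "wedge e f = m e * m f * \<bar>s f - s e\<bar>"

text \<open>Right derivative at \<open>c\<close> of the sum of
  \<open>m e * m f * \<bar>h f - h e\<bar>\<close> over ordered pairs of crossed bars;
  \<open>Qminus\<close> is the left derivative.\<close>

definition Qplus :: "real \<Rightarrow> real" where
  "Qplus c = (\<Sum>e\<in>after c. \<Sum>f\<in>after c. m e * m f * dplus (h f c - h e c) (s f - s e))"

definition Qminus :: "real \<Rightarrow> real" where
  "Qminus c = (\<Sum>e\<in>before c. \<Sum>f\<in>before c. m e * m f * dminus (h f c - h e c) (s f - s e))"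

text \<open>What the node \<open>v\<close> is guaranteed to contribute to the jump of the
  functional. Outgoing and incoming bars are paired separately, and ordered pairs count every pair
  twice.\<close>

definition mass :: "'v \<Rightarrow> real" where
  "mass v = (\<Sum>e | e \<in> E \<and> L e = v. \<Sum>f | f \<in> E \<and> L f = v. wedge e f)
          + (\<Sum>e | e \<in> E \<and> R e = v. \<Sum>f | f \<in> E \<and> R f = v. wedge e f)"

lemma wedge_nonneg: "e \<in> E \<Longrightarrow> f \<in> E \<Longrightarrow> 0 \<le> wedge e f"
  by (simp add: wedge_def m_nonneg)

lemma wedge_commute: "wedge e f = wedge f e"
  by (simp add: wedge_def abs_minus_commute mult.commute)

lemma finite_after [simp]: "finite (after c)" and finite_before [simp]: "finite (before c)"
  using finite_E by (simp_all add: after_def before_def)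

lemma h_L: "h e (x (L e)) = y (L e)"
  by (simp add: h_def)

lemma h_R: "e \<in> E \<Longrightarrow> h e (x (R e)) = y (R e)"
  by (simp add: h_def slope)

text \<open>Without nodes in between, the line crosses the same bars all the way, and each summand
  is a nonnegative multiple of the derivative of a convex function.\<close>

lemma Qplus_le_Qminus:
  assumes "c < d" and no: "\<And>v. v \<in> V \<Longrightarrow> \<not> (c < x v \<and> x v < d)"
  shows "Qplus c \<le> Qminus d"
proof -
  have eq: "after c = before d"
    unfolding after_def before_def using no L_in R_in assms(1) by force
  show ?thesis
    unfolding Qplus_def Qminus_def eq
  proof (intro sum_mono)
    fix e f assume ef: "e \<in> before d" "f \<in> before d"
    then have "0 \<le> m e * m f" by (simp add: before_def m_nonneg)
    moreover have "h f d - h e d = (h f c - h e c) + (s f - s e) * (d - c)"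
      by (simp add: h_def algebra_simps)
    ultimately show "m e * m f * dplus (h f c - h e c) (s f - s e)
        \<le> m e * m f * dminus (h f d - h e d) (s f - s e)"
      using dplus_le_dminus[of "d - c" "h f c - h e c" "s f - s e"] assms(1)
      by (intro mult_left_mono) auto
  qed
qed

text \<open>All bars at a node on the line have the same height there, so \<open>g\<close> factors
  out of the block of that node and equilibrium exchanges outgoing for incoming bars. Bars crossing
  the line at an interior point occur on both sides. The weight \<open>p\<close> will be
  \<open>m\<close> or \<open>m * s\<close>.\<close>

lemma sum_after_eq_sum_before:
  assumes bal: "\<And>v. v \<in> V \<Longrightarrow> x v = c \<Longrightarrow>
      (\<Sum>e | e \<in> E \<and> L e = v. p e) = (\<Sum>e | e \<in> E \<and> R e = v. p e)"
  shows "(\<Sum>e\<in>after c. p e * g (h e c)) = (\<Sum>e\<in>before c. p e * (g (h e c) :: real))"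
proof -
  let ?P = "{e \<in> E. x (L e) < c \<and> c < x (R e)}"
  let ?A = "{e \<in> E. x (L e) = c}" and ?B = "{e \<in> E. x (R e) = c}"
  let ?W = "{v \<in> V. x v = c}"
  let ?q = "\<lambda>e. p e * g (h e c)"
  have a: "after c = ?P \<union> ?A" unfolding after_def using L_less_R by force
  have b: "before c = ?P \<union> ?B" unfolding before_def using L_less_R by force
  have 1: "sum ?q (after c) = sum ?q ?P + sum ?q ?A"
    unfolding a using finite_E by (intro sum.union_disjoint) auto
  have 2: "sum ?q (before c) = sum ?q ?P + sum ?q ?B"
    unfolding b using finite_E by (intro sum.union_disjoint) auto
  have "sum ?q ?A = (\<Sum>v\<in>?W. \<Sum>e | e \<in> ?A \<and> L e = v. ?q e)"
    using finite_E finite_V L_in by (intro sum.group[symmetric]) auto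
  also have "\<dots> = (\<Sum>v\<in>?W. g (y v) * (\<Sum>e | e \<in> E \<and> L e = v. p e))"
    unfolding sum_distrib_left by (intro sum.cong) (auto simp: h_L)
  also have "\<dots> = (\<Sum>v\<in>?W. g (y v) * (\<Sum>e | e \<in> E \<and> R e = v. p e))"
    using bal by (intro sum.cong) auto
  also have "\<dots> = (\<Sum>v\<in>?W. \<Sum>e | e \<in> ?B \<and> R e = v. ?q e)"
    unfolding sum_distrib_left by (intro sum.cong) (auto simp: h_R)
  also have "\<dots> = sum ?q ?B"
    using finite_E finite_V R_in by (intro sum.group) auto
  finally show ?thesis using 1 2 by simp
qed

text \<open>Expanding \<open>s f - s e\<close> leaves double sums weighted by \<open>m\<close> in
  one variable and by \<open>m * s\<close> in the other, with a coefficient depending on heights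
  only. Each variable is then transferred separately.\<close>

lemma sum_sgn_transfer:
  assumes "A < c" "c < B"
  shows "(\<Sum>e\<in>after c. \<Sum>f\<in>after c. m e * m f * (sgn (h f c - h e c) * (s f - s e)))
       = (\<Sum>e\<in>before c. \<Sum>f\<in>before c. m e * m f * (sgn (h f c - h e c) * (s f - s e)))"
proof -
  have tm: "(\<Sum>e\<in>after c. m e * g (h e c)) = (\<Sum>e\<in>before c. m e * g (h e c))" for g
    using assms balance_m by (intro sum_after_eq_sum_before) auto
  have ts: "(\<Sum>e\<in>after c. m e * s e * g (h e c)) = (\<Sum>e\<in>before c. m e * s e * g (h e c))" for g
    using assms balance_ms by (intro sum_after_eq_sum_before) auto
  have split: "(\<Sum>e\<in>S. \<Sum>f\<in>S. m e * m f * (sgn (h f c - h e c) * (s f - s e)))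
      = (\<Sum>e\<in>S. m e * (\<Sum>f\<in>S. m f * s f * sgn (h f c - h e c)))
      - (\<Sum>e\<in>S. m e * s e * (\<Sum>f\<in>S. m f * sgn (h f c - h e c)))" for S
    by (simp add: sum_distrib_left algebra_simps sum_subtractf)
  have "(\<Sum>e\<in>after c. m e * (\<Sum>f\<in>after c. m f * s f * sgn (h f c - h e c)))
      = (\<Sum>e\<in>before c. m e * (\<Sum>f\<in>before c. m f * s f * sgn (h f c - h e c)))"
    \<comment> \<open>First the inner sum is moved with the height of \<open>e\<close> frozen; the
      result is a function of that height and serves as \<open>g\<close> for the outer sum.\<close>
    unfolding ts[of "\<lambda>u. sgn (u - _)"]
    by (rule tm[of "\<lambda>w. \<Sum>f\<in>before c. m f * s f * sgn (h f c - w)"])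
  moreover have "(\<Sum>e\<in>after c. m e * s e * (\<Sum>f\<in>after c. m f * sgn (h f c - h e c)))
      = (\<Sum>e\<in>before c. m e * s e * (\<Sum>f\<in>before c. m f * sgn (h f c - h e c)))"
    unfolding tm[of "\<lambda>u. sgn (u - _)"]
    by (rule ts[of "\<lambda>w. \<Sum>f\<in>before c. m f * sgn (h f c - w)"])
  ultimately show ?thesis unfolding split by simp
qed

text \<open>The blocks of different nodes consist of different bars, and inside a block all heights
  agree, so the blocks are disjoint parts of the sum on the right. \<open>P\<close> stands for
  \<open>L\<close> or \<open>R\<close>.\<close>

lemma disjoint_blocks_le:
  assumes "finite S" "finite W" "S \<subseteq> E"
    and "\<And>v e. v \<in> W \<Longrightarrow> e \<in> E \<Longrightarrow> P e = v \<Longrightarrow> e \<in> S \<and> h e c = y v"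
  shows "(\<Sum>v\<in>W. \<Sum>e | e \<in> E \<and> P e = v. \<Sum>f | f \<in> E \<and> P f = v. wedge e f)
    \<le> (\<Sum>e\<in>S. \<Sum>f\<in>S. if h f c = h e c then wedge e f else 0)"
proof -
  let ?G = "\<lambda>e f. if h f c = h e c then wedge e f else 0"
  have "(\<Sum>v\<in>W. \<Sum>e | e \<in> E \<and> P e = v. \<Sum>f | f \<in> E \<and> P f = v. wedge e f)
      \<le> (\<Sum>v\<in>W. \<Sum>e | e \<in> {e \<in> E. P e \<in> W} \<and> P e = v. \<Sum>f\<in>S. ?G e f)"
  proof (intro sum_mono)
    fix v assume v: "v \<in> W"
    have block: "{e. e \<in> {e \<in> E. P e \<in> W} \<and> P e = v} = {e. e \<in> E \<and> P e = v}"
      using v by auto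
    show "(\<Sum>e | e \<in> E \<and> P e = v. \<Sum>f | f \<in> E \<and> P f = v. wedge e f)
        \<le> (\<Sum>e | e \<in> {e \<in> E. P e \<in> W} \<and> P e = v. \<Sum>f\<in>S. ?G e f)"
      unfolding block
    proof (intro sum_mono)
      fix e assume e: "e \<in> {e. e \<in> E \<and> P e = v}"
      have "(\<Sum>f | f \<in> E \<and> P f = v. wedge e f) = (\<Sum>f | f \<in> E \<and> P f = v. ?G e f)"
        using e v assms(4) by (intro sum.cong) auto
      also have "\<dots> \<le> (\<Sum>f\<in>S. ?G e f)"
        using assms v e wedge_nonneg by (intro sum_mono2) auto
      finally show "(\<Sum>f | f \<in> E \<and> P f = v. wedge e f) \<le> (\<Sum>f\<in>S. ?G e f)" .
    qed
  qed
  also have "\<dots> = (\<Sum>e\<in>{e \<in> E. P e \<in> W}. \<Sum>f\<in>S. ?G e f)"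
    using finite_E assms(2) by (intro sum.group) auto
  also have "\<dots> \<le> (\<Sum>e\<in>S. \<Sum>f\<in>S. ?G e f)"
    using assms(1,4) wedge_nonneg subsetD[OF assms(3)]
    by (intro sum_mono2 sum_nonneg) (auto split: if_splits)
  finally show ?thesis .
qed

text \<open>Both one-sided derivatives consist of a sign term, continuous across \<open>c\<close> by
  equilibrium, and of the wedge terms of bars meeting at equal height. The latter enter
  \<open>Qplus\<close> with a plus and \<open>Qminus\<close> with a minus sign, so both kinds
  increase the jump.\<close>

lemma Q_jump:
  assumes "A < c" "c < B"
  shows "Qminus c + (\<Sum>v | v \<in> V \<and> x v = c. mass v) \<le> Qplus c"
proof -
  let ?G = "\<lambda>e f. if h f c = h e c then wedge e f else 0"
  let ?D = "\<lambda>e f. m e * m f * (sgn (h f c - h e c) * (s f - s e))"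
  let ?W = "{v \<in> V. x v = c}"
  have "Qplus c = (\<Sum>e\<in>after c. \<Sum>f\<in>after c. ?D e f + ?G e f)"
    unfolding Qplus_def by (intro sum.cong) (auto simp: dplus_def wedge_def)
  then have p: "Qplus c = (\<Sum>e\<in>after c. \<Sum>f\<in>after c. ?D e f) + (\<Sum>e\<in>after c. \<Sum>f\<in>after c. ?G e f)"
    by (simp add: sum.distrib)
  have "Qminus c = (\<Sum>e\<in>before c. \<Sum>f\<in>before c. ?D e f - ?G e f)"
    unfolding Qminus_def by (intro sum.cong) (auto simp: dminus_def wedge_def)
  then have q: "Qminus c = (\<Sum>e\<in>before c. \<Sum>f\<in>before c. ?D e f) - (\<Sum>e\<in>before c. \<Sum>f\<in>before c. ?G e f)"
    by (simp add: sum_subtractf)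
  have l: "(\<Sum>v\<in>?W. \<Sum>e | e \<in> E \<and> L e = v. \<Sum>f | f \<in> E \<and> L f = v. wedge e f)
      \<le> (\<Sum>e\<in>after c. \<Sum>f\<in>after c. ?G e f)"
    using finite_V L_less_R h_L by (intro disjoint_blocks_le finite_after) (auto simp: after_def)
  have r: "(\<Sum>v\<in>?W. \<Sum>e | e \<in> E \<and> R e = v. \<Sum>f | f \<in> E \<and> R f = v. wedge e f)
      \<le> (\<Sum>e\<in>before c. \<Sum>f\<in>before c. ?G e f)"
    using finite_V L_less_R h_R by (intro disjoint_blocks_le finite_before) (auto simp: before_def)
  show ?thesis
    using l r unfolding p q mass_def sum.distrib sum_sgn_transfer[OF assms] by simp
qed

lemma mass_le_Q_diff:
  assumes "A \<le> c" "c < d" "d \<le> B"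
  shows "Qplus c + (\<Sum>v | v \<in> V \<and> c < x v \<and> x v < d. mass v) \<le> Qminus d"
  using assms(2,3)
proof (induction "card (x ` {v \<in> V. c < x v \<and> x v < d})" arbitrary: d rule: less_induct)
  case less
  let ?S = "\<lambda>d. {v \<in> V. c < x v \<and> x v < d}"
  show ?case
  proof (cases "?S d = {}")
    case True
    then show ?thesis using Qplus_le_Qminus[of c d] less.prems by (auto simp del: Collect_empty_eq)
  next
    case False
    have fin: "finite (x ` ?S d)" using finite_V by simp
    \<comment> \<open>The strip is peeled from the right: \<open>b\<close> is the last node
      abscissa, the induction reaches it from the left, and no node remains between \<open>b\<close>
      and \<open>d\<close>.\<close>
    define b where "b = Max (x ` ?S d)"
    have b_in: "b \<in> x ` ?S d" unfolding b_def using fin False by (intro Max_in) auto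
    have b_max: "x v \<le> b" if "v \<in> ?S d" for v
      unfolding b_def using fin that by (intro Max_ge) auto
    have b: "c < b" "b < d" using b_in by auto
    have sub: "x ` ?S b \<subset> x ` ?S d" using b b_in by force
    have "card (x ` ?S b) < card (x ` ?S d)"
      using fin sub by (intro psubset_card_mono) auto
    then have 1: "Qplus c + sum mass (?S b) \<le> Qminus b"
      using less.hyps b less.prems by simp
    have 2: "Qminus b + (\<Sum>v | v \<in> V \<and> x v = b. mass v) \<le> Qplus b"
      using b less.prems assms(1) by (intro Q_jump) auto
    have 3: "Qplus b \<le> Qminus d"
      using b b_max by (intro Qplus_le_Qminus) force+
    have "?S d = ?S b \<union> {v \<in> V. x v = b}" using b b_max by force
    then have "sum mass (?S d) = sum mass (?S b) + sum mass {v \<in> V. x v = b}"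
      using finite_V by (simp add: sum.union_disjoint[symmetric] disjoint_iff)
    then show ?thesis using 1 2 3 by simp
  qed
qed

lemma abs_pair_sum_le:
  assumes "finite S" "S \<subseteq> E" "\<And>e f. \<bar>D e f\<bar> \<le> \<bar>s f - s e\<bar>"
  shows "\<bar>\<Sum>e\<in>S. \<Sum>f\<in>S. m e * m f * D e f\<bar> \<le> 2 * (\<Sum>e\<in>S. m e) * (\<Sum>e\<in>S. m e * \<bar>s e\<bar>)"
proof -
  have "\<bar>\<Sum>e\<in>S. \<Sum>f\<in>S. m e * m f * D e f\<bar> \<le> (\<Sum>e\<in>S. \<Sum>f\<in>S. \<bar>m e * m f * D e f\<bar>)"
    by (intro order_trans[OF sum_abs] sum_mono) simp
  also have "\<dots> \<le> (\<Sum>e\<in>S. \<Sum>f\<in>S. m e * (m f * \<bar>s f\<bar>) + m e * \<bar>s e\<bar> * m f)"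
  proof (intro sum_mono)
    fix e f assume "e \<in> S" "f \<in> S"
    then have n: "0 \<le> m e * m f" using assms(2) m_nonneg by (intro mult_nonneg_nonneg) auto
    have "\<bar>m e * m f * D e f\<bar> = m e * m f * \<bar>D e f\<bar>" using n by (metis abs_mult abs_of_nonneg)
    also have "\<dots> \<le> m e * m f * (\<bar>s f\<bar> + \<bar>s e\<bar>)"
      using assms(3)[of e f] n by (intro mult_left_mono) auto
    finally show "\<bar>m e * m f * D e f\<bar> \<le> m e * (m f * \<bar>s f\<bar>) + m e * \<bar>s e\<bar> * m f"
      by (simp add: algebra_simps)
  qed
  also have "\<dots> = 2 * (\<Sum>e\<in>S. m e) * (\<Sum>e\<in>S. m e * \<bar>s e\<bar>)"
    unfolding sum.distrib sum_product[symmetric] by simp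
  finally show ?thesis .
qed

text \<open>The total jump is at most the difference of the functional at the two ends of the strip,
  and each end value involves only the bars crossing there; each contributes a factor 2.\<close>

lemma mass_bound:
  assumes "A < B" "finite S" "S \<subseteq> E" "after A \<subseteq> S" "before B \<subseteq> S"
  shows "(\<Sum>v | v \<in> V \<and> A < x v \<and> x v < B. mass v) \<le> 4 * (\<Sum>e\<in>S. m e) * (\<Sum>e\<in>S. m e * \<bar>s e\<bar>)"
proof -
  have mono: "2 * (\<Sum>e\<in>T. m e) * (\<Sum>e\<in>T. m e * \<bar>s e\<bar>) \<le> 2 * (\<Sum>e\<in>S. m e) * (\<Sum>e\<in>S. m e * \<bar>s e\<bar>)"
    if "T \<subseteq> S" for T
    using that assms(2,3) m_nonneg
    by (intro mult_mono mult_left_mono sum_mono2 mult_nonneg_nonneg sum_nonneg)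
       (auto intro!: mult_nonneg_nonneg simp: subset_iff)
  have "\<bar>Qplus A\<bar> \<le> 2 * (\<Sum>e\<in>after A. m e) * (\<Sum>e\<in>after A. m e * \<bar>s e\<bar>)"
    unfolding Qplus_def by (intro abs_pair_sum_le abs_dplus_le) (auto simp: after_def finite_E)
  moreover have "\<bar>Qminus B\<bar> \<le> 2 * (\<Sum>e\<in>before B. m e) * (\<Sum>e\<in>before B. m e * \<bar>s e\<bar>)"
    unfolding Qminus_def by (intro abs_pair_sum_le abs_dminus_le) (auto simp: before_def finite_E)
  ultimately show ?thesis
    using mass_le_Q_diff[of A B] assms(1) mono[OF assms(4)] mono[OF assms(5)] by auto
qed

lemma mass_ge_pair:
  assumes "e \<in> E" "f \<in> E" "e \<noteq> f" "(L e = v \<and> L f = v) \<or> (R e = v \<and> R f = v)"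
  shows "2 * wedge e f \<le> mass v"
proof -
  have nn: "0 \<le> (\<Sum>e | e \<in> E \<and> P e = v. \<Sum>f | f \<in> E \<and> P f = v. wedge e f)" for P
    by (intro sum_nonneg) (auto intro: wedge_nonneg)
  have main: "2 * wedge e f \<le> (\<Sum>e | e \<in> E \<and> P e = v. \<Sum>f | f \<in> E \<and> P f = v. wedge e f)"
    if P: "P e = v" "P f = v" for P
  proof -
    let ?T = "{e. e \<in> E \<and> P e = v}"
    have 1: "wedge a b \<le> (\<Sum>f\<in>?T. wedge a f)" if "a \<in> ?T" "b \<in> ?T" for a b
      using that finite_E wedge_nonneg by (intro member_le_sum) auto
    have "2 * wedge e f = wedge e f + wedge f e" by (simp add: wedge_commute)
    also have "\<dots> \<le> (\<Sum>a\<in>{e, f}. \<Sum>b\<in>?T. wedge a b)"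
      using 1[of e f] 1[of f e] assms P by simp
    also have "\<dots> \<le> (\<Sum>a\<in>?T. \<Sum>b\<in>?T. wedge a b)"
      using assms P finite_E wedge_nonneg by (intro sum_mono2 sum_nonneg) auto
    finally show ?thesis .
  qed
  show ?thesis
    using assms(4) main[of L] main[of R] nn[of L] nn[of R] unfolding mass_def by fastforce
qed

lemma mass_nonneg: "0 \<le> mass v"
  unfolding mass_def by (intro add_nonneg_nonneg sum_nonneg) (auto intro: wedge_nonneg)

text \<open>Of three bars ending at \<open>v\<close>, two lie on the same side of the sweeping line through \<open>v\<close>.\<close>

lemma mass_ge_triple:
  assumes "e \<in> E" "f \<in> E" "g \<in> E" "e \<noteq> f" "f \<noteq> g" "e \<noteq> g"
    and "v \<in> {L e, R e}" "v \<in> {L f, R f}" "v \<in> {L g, R g}"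
    and "w \<le> wedge e f" "w \<le> wedge f g" "w \<le> wedge e g"
  shows "2 * w \<le> mass v"
  using assms mass_ge_pair[of e f v] mass_ge_pair[of f g v] mass_ge_pair[of e g v] by auto

end

section \<open>From forces on a graph to a planar stress\<close>

text \<open>Each edge carries a force that is a nonnegative multiple of its displacement. Directing
  all edges to the right, with slope \<open>G e / F e\<close>, yields a
  \<open>planar_stress\<close>; an edge with \<open>F e = 0\<close> has no force at all by
  \<open>generic\<close> and is dropped. Three edges at \<open>v\<close> are asked for because their
  left or right position is not known in advance.\<close>

lemma stress_graph_bound:
  fixes x y :: "'v \<Rightarrow> real" and p q :: "'e \<Rightarrow> 'v" and F G lam :: "'e \<Rightarrow> real" and w :: "'v \<Rightarrow> real"
  assumes fin: "finite E" "finite V" and pq: "\<And>e. e \<in> E \<Longrightarrow> p e \<in> V" "\<And>e. e \<in> E \<Longrightarrow> q e \<in> V"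
    and lam: "\<And>e. e \<in> E \<Longrightarrow> 0 \<le> lam e"
    and F: "\<And>e. e \<in> E \<Longrightarrow> F e = lam e * (x (q e) - x (p e))"
    and G: "\<And>e. e \<in> E \<Longrightarrow> G e = lam e * (y (q e) - y (p e))"
    and generic: "\<And>e. e \<in> E \<Longrightarrow> F e = 0 \<Longrightarrow> G e = 0"
    and balF: "\<And>v. v \<in> V \<Longrightarrow> A < x v \<Longrightarrow> x v < B \<Longrightarrow>
      (\<Sum>e | e \<in> E \<and> p e = v. F e) = (\<Sum>e | e \<in> E \<and> q e = v. F e)"
    and balG: "\<And>v. v \<in> V \<Longrightarrow> A < x v \<Longrightarrow> x v < B \<Longrightarrow>
      (\<Sum>e | e \<in> E \<and> p e = v. G e) = (\<Sum>e | e \<in> E \<and> q e = v. G e)"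
    and "A < B" and S: "S \<subseteq> E"
    and inner: "\<And>e. e \<in> E - S \<Longrightarrow> F e \<noteq> 0 \<Longrightarrow> {x (p e), x (q e)} \<subseteq> {A<..<B}"
    and K: "K \<subseteq> V" "\<And>v. v \<in> K \<Longrightarrow> A < x v \<and> x v < B"
    and triple: "\<And>v. v \<in> K \<Longrightarrow> \<exists>e\<in>E. \<exists>f\<in>E. \<exists>g\<in>E. e \<noteq> f \<and> f \<noteq> g \<and> e \<noteq> g \<and>
      v \<in> {p e, q e} \<and> v \<in> {p f, q f} \<and> v \<in> {p g, q g} \<and>
      w v \<le> \<bar>F e * G f - G e * F f\<bar> \<and> w v \<le> \<bar>F f * G g - G f * F g\<bar> \<and>
      w v \<le> \<bar>F e * G g - G e * F g\<bar>"
  shows "(\<Sum>v\<in>K. w v) \<le> 2 * (\<Sum>e\<in>S. \<bar>F e\<bar>) * (\<Sum>e\<in>S. \<bar>G e\<bar>)"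
proof -
  define E' where "E' = {e \<in> E. F e \<noteq> 0}"
  define L where "L e = (if F e > 0 then p e else q e)" for e
  define R where "R e = (if F e > 0 then q e else p e)" for e
  define m where "m e = \<bar>F e\<bar>" for e
  define s where "s e = G e / F e" for e
  have lam_pos: "lam e > 0" if "e \<in> E'" for e
    using that lam[of e] F[of e] by (cases "lam e = 0") (auto simp: E'_def)
  \<comment> \<open>Reversing an edge exchanges its ends and changes the sign of its force, which
    leaves the difference of outgoing and incoming force at a node unchanged.\<close>
  have orient: "(\<Sum>e | e \<in> E' \<and> L e = v. sgn (F e) * H e) = (\<Sum>e | e \<in> E' \<and> R e = v. sgn (F e) * H e)"
    if "(\<Sum>e | e \<in> E \<and> p e = v. H e) = (\<Sum>e | e \<in> E \<and> q e = v. H e)"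
      and H: "\<And>e. e \<in> E \<Longrightarrow> F e = 0 \<Longrightarrow> H e = 0" for v and H :: "'e \<Rightarrow> real"
  proof -
    have conv: "(\<Sum>e | e \<in> X \<and> P e. h e) = (\<Sum>e\<in>E. if e \<in> X \<and> P e then h e else 0)"
      if "X \<subseteq> E" for X P and h :: "'e \<Rightarrow> real"
      using fin(1) that by (subst sum.inter_filter[symmetric]) (auto intro: sum.cong)
    have "(\<Sum>e | e \<in> E' \<and> L e = v. sgn (F e) * H e) - (\<Sum>e | e \<in> E' \<and> R e = v. sgn (F e) * H e)
        = (\<Sum>e\<in>E. (if e \<in> E' \<and> L e = v then sgn (F e) * H e else 0)
            - (if e \<in> E' \<and> R e = v then sgn (F e) * H e else 0))"
      unfolding sum_subtractf by (subst (1 2) conv) (auto simp: E'_def)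
    also have "\<dots> = (\<Sum>e\<in>E. (if e \<in> E \<and> p e = v then H e else 0)
            - (if e \<in> E \<and> q e = v then H e else 0))"
      using H by (intro sum.cong) (auto simp: E'_def L_def R_def sgn_if)
    also have "\<dots> = (\<Sum>e | e \<in> E \<and> p e = v. H e) - (\<Sum>e | e \<in> E \<and> q e = v. H e)"
      unfolding sum_subtractf by (subst (1 2) conv) auto
    finally show ?thesis using that(1) by simp
  qed
  have m_eq: "m e = sgn (F e) * F e" for e by (simp add: m_def sgn_if)
  have ms_eq: "m e * s e = sgn (F e) * G e" if "e \<in> E'" for e
    using that by (auto simp: m_def s_def E'_def sgn_if)
  interpret planar_stress E' V L R x y m s A B
  proof
    show "finite E'" "finite V" using fin by (auto simp: E'_def)
    show "L e \<in> V" "R e \<in> V" if "e \<in> E'" for e using that pq by (auto simp: E'_def L_def R_def)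
    show "x (L e) < x (R e)" if "e \<in> E'" for e
      using that lam_pos[OF that] F[of e]
      by (auto simp: E'_def L_def R_def zero_less_mult_iff not_less mult_le_0_iff)
    show "0 \<le> m e" if "e \<in> E'" for e by (simp add: m_def)
    show "y (R e) = y (L e) + s e * (x (R e) - x (L e))" if "e \<in> E'" for e
    proof -
      have "F e \<noteq> 0" "e \<in> E" using that by (auto simp: E'_def)
      then have "s e * (x (q e) - x (p e)) = y (q e) - y (p e)"
        using F[of e] G[of e] by (simp add: s_def)
      then show ?thesis by (auto simp: L_def R_def algebra_simps)
    qed
    show "(\<Sum>e | e \<in> E' \<and> L e = v. m e) = (\<Sum>e | e \<in> E' \<and> R e = v. m e)"
      if "v \<in> V" "A < x v" "x v < B" for v
      unfolding m_eq using orient[OF balF[OF that]] by simp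
    show "(\<Sum>e | e \<in> E' \<and> L e = v. m e * s e) = (\<Sum>e | e \<in> E' \<and> R e = v. m e * s e)"
      if "v \<in> V" "A < x v" "x v < B" for v
      using orient[OF balG[OF that] generic] by (simp add: ms_eq cong: conj_cong)
  qed
  have wedge_eq: "wedge e f = \<bar>F e * G f - G e * F f\<bar>" if "e \<in> E'" "f \<in> E'" for e f
  proof -
    have "F e \<noteq> 0" "F f \<noteq> 0" using that by (auto simp: E'_def)
    then have "F e * G f - G e * F f = F e * F f * (s f - s e)"
      by (simp add: s_def field_simps)
    then show ?thesis by (simp add: wedge_def m_def abs_mult)
  qed
  have mass_w: "2 * w v \<le> mass v" if v: "v \<in> K" for v
  proof (cases "w v \<le> 0")
    case True
    then show ?thesis using mass_nonneg[of v] by linarith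
  next
    case False
    obtain e f g where efg: "e \<in> E" "f \<in> E" "g \<in> E" "e \<noteq> f" "f \<noteq> g" "e \<noteq> g"
      and inc: "v \<in> {p e, q e}" "v \<in> {p f, q f}" "v \<in> {p g, q g}"
      and w: "w v \<le> \<bar>F e * G f - G e * F f\<bar>" "w v \<le> \<bar>F f * G g - G f * F g\<bar>"
        "w v \<le> \<bar>F e * G g - G e * F g\<bar>"
      using triple[OF v] by blast
    \<comment> \<open>A positive \<open>w v\<close> makes all three wedges nonzero, which excludes
      edges with zero force.\<close>
    have nz: "e \<in> E'" "f \<in> E'" "g \<in> E'"
      using False efg w generic by (auto simp: E'_def)
    show ?thesis
      using efg inc w nz by (intro mass_ge_triple[of e f g]) (auto simp: L_def R_def wedge_eq)
  qed
  let ?S = "S \<inter> E'"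
  have "2 * (\<Sum>v\<in>K. w v) \<le> (\<Sum>v\<in>K. mass v)"
    unfolding sum_distrib_left by (intro sum_mono mass_w)
  also have "\<dots> \<le> (\<Sum>v | v \<in> V \<and> A < x v \<and> x v < B. mass v)"
    using K fin(2) mass_nonneg by (intro sum_mono2) auto
  also have "\<dots> \<le> 4 * (\<Sum>e\<in>?S. m e) * (\<Sum>e\<in>?S. m e * \<bar>s e\<bar>)"
  proof (rule mass_bound[OF \<open>A < B\<close>])
    show "finite ?S" using fin(1) by (simp add: E'_def)
    \<comment> \<open>A force-carrying edge that reaches an end of the strip must belong to
      \<open>S\<close>, by \<open>inner\<close>.\<close>
    have in_S: "e \<in> ?S" if "e \<in> E'" "x (L e) \<le> A \<or> B \<le> x (R e)" for e
    proof -
      have "\<not> {x (p e), x (q e)} \<subseteq> {A<..<B}"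
        using that(2) by (auto simp: L_def R_def split: if_splits)
      then show ?thesis using that(1) inner[of e] S by (auto simp: E'_def)
    qed
    show "after A \<subseteq> ?S" unfolding after_def using in_S by blast
    show "before B \<subseteq> ?S" unfolding before_def using in_S by blast
  qed simp
  finally have le: "(\<Sum>v\<in>K. w v) \<le> 2 * ((\<Sum>e\<in>?S. m e) * (\<Sum>e\<in>?S. m e * \<bar>s e\<bar>))"
    by simp
  have fin_S: "finite S" using fin(1) S by (rule finite_subset[rotated])
  have "(\<Sum>e\<in>?S. m e) \<le> (\<Sum>e\<in>S. \<bar>F e\<bar>)"
    unfolding m_def using fin_S by (intro sum_mono2) auto
  moreover have "(\<Sum>e\<in>?S. m e * \<bar>s e\<bar>) \<le> (\<Sum>e\<in>S. \<bar>G e\<bar>)"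
  proof -
    have "(\<Sum>e\<in>?S. m e * \<bar>s e\<bar>) = (\<Sum>e\<in>?S. \<bar>G e\<bar>)"
      by (intro sum.cong) (auto simp: m_def s_def E'_def)
    also have "\<dots> \<le> (\<Sum>e\<in>S. \<bar>G e\<bar>)"
      using fin_S by (intro sum_mono2) auto
    finally show ?thesis .
  qed
  ultimately have "(\<Sum>e\<in>?S. m e) * (\<Sum>e\<in>?S. m e * \<bar>s e\<bar>) \<le> (\<Sum>e\<in>S. \<bar>F e\<bar>) * (\<Sum>e\<in>S. \<bar>G e\<bar>)"
    by (intro mult_mono sum_nonneg) (auto simp: m_def)
  then show ?thesis using le by (simp add: mult.assoc)
qed

section \<open>Frameworks of planar trajectories\<close>

text \<open>Events \<open>1..K\<close> are the collision times, while \<open>0\<close> and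
  \<open>Suc K\<close> mark artificial ends of the incoming and outgoing rays;
  \<open>(u k i, v k i)\<close> is the velocity between events \<open>k\<close> and
  \<open>Suc k\<close>. Collisions lie inside the strip and the ends of rays with nonzero
  \<open>u\<close> outside, so the edge forces balance at every node in the strip.\<close>

lemma planar_bound_generic:
  fixes px py u v kap :: "nat \<Rightarrow> nat \<Rightarrow> real" and tau :: "nat \<Rightarrow> real" and b :: "nat \<Rightarrow> nat \<Rightarrow> nat"
  assumes K: "K \<ge> 1" and tau: "\<And>k. k \<le> K \<Longrightarrow> tau k > 0"
    and px: "\<And>k i. k \<le> K \<Longrightarrow> i < N \<Longrightarrow> px (Suc k) i = px k i + tau k * u k i"
    and py: "\<And>k i. k \<le> K \<Longrightarrow> i < N \<Longrightarrow> py (Suc k) i = py k i + tau k * v k i"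
    and b: "\<And>k i. k < K \<Longrightarrow> i < N \<Longrightarrow> b (Suc k) i < N"
      "\<And>k i. k < K \<Longrightarrow> i < N \<Longrightarrow> b (Suc k) (b (Suc k) i) = i"
    and kap: "\<And>k i. k < K \<Longrightarrow> i < N \<Longrightarrow> 0 \<le> kap (Suc k) i"
      "\<And>k i. k < K \<Longrightarrow> i < N \<Longrightarrow> kap (Suc k) (b (Suc k) i) = kap (Suc k) i"
    and u: "\<And>k i. k < K \<Longrightarrow> i < N \<Longrightarrow>
      u (Suc k) i = u k i - kap (Suc k) i * (px (Suc k) (b (Suc k) i) - px (Suc k) i)"
    and v: "\<And>k i. k < K \<Longrightarrow> i < N \<Longrightarrow>
      v (Suc k) i = v k i - kap (Suc k) i * (py (Suc k) (b (Suc k) i) - py (Suc k) i)"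
    and gen: "\<And>k i. k \<le> K \<Longrightarrow> i < N \<Longrightarrow> u k i = 0 \<Longrightarrow> v k i = 0"
      "\<And>k i. k < K \<Longrightarrow> i < N \<Longrightarrow> px (Suc k) (b (Suc k) i) = px (Suc k) i \<Longrightarrow>
        py (Suc k) (b (Suc k) i) = py (Suc k) i"
    and "A < B"
    and inside: "\<And>k i. k < K \<Longrightarrow> i < N \<Longrightarrow> A < px (Suc k) i \<and> px (Suc k) i < B"
    and outside: "\<And>i. i < N \<Longrightarrow> u 0 i \<noteq> 0 \<Longrightarrow> px 0 i \<notin> {A<..<B}"
      "\<And>i. i < N \<Longrightarrow> u K i \<noteq> 0 \<Longrightarrow> px (Suc K) i \<notin> {A<..<B}"
  shows "(\<Sum>k<K. \<Sum>i<N. \<bar>u k i * v (Suc k) i - v k i * u (Suc k) i\<bar>)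
    \<le> 4 * (\<Sum>i<N. \<bar>u 0 i\<bar> + \<bar>u K i\<bar>) * (\<Sum>i<N. \<bar>v 0 i\<bar> + \<bar>v K i\<bar>)"
proof -
  \<comment> \<open>The edges \<open>(True, k, i)\<close> are pieces of trajectories. The rod transmitting the impulse between
    \<open>i\<close> and \<open>b k i\<close> occurs twice, as \<open>(False, k, i)\<close> and \<open>(False, k, b k i)\<close>, each time
    with half the force.\<close>
  define pieces where "pieces = {True} \<times> {..K} \<times> {..<N}"
  define rods where "rods = {False} \<times> {1..K} \<times> {..<N}"
  define p where "p = (\<lambda>(c::bool, k::nat, i::nat). (k, i))"
  define q where "q = (\<lambda>(c, k, i). if c then (Suc k, i) else (k, b k i))"
  define x where "x = (\<lambda>(k, i). px k i)"
  define y where "y = (\<lambda>(k, i). py k i)"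
  define lam where "lam = (\<lambda>(c, k, i). if c then 1 / tau k else kap k i / 2)"
  define F where "F e = lam e * (x (q e) - x (p e))" for e
  define G where "G e = lam e * (y (q e) - y (p e))" for e
  have tau': "tau k \<noteq> 0" if "k \<le> K" for k using tau[OF that] by simp
  have F_piece: "F (True, k, i) = u k i" if "k \<le> K" "i < N" for k i
    using that px tau'[of k] by (simp add: F_def lam_def x_def p_def q_def)
  have G_piece: "G (True, k, i) = v k i" if "k \<le> K" "i < N" for k i
    using that py tau'[of k] by (simp add: G_def lam_def y_def p_def q_def)
  have F_rod: "F (False, Suc k, i) = (u k i - u (Suc k) i) / 2" if "k < K" "i < N" for k i
    using that u[of k i] by (simp add: F_def lam_def x_def p_def q_def)
  have G_rod: "G (False, Suc k, i) = (v k i - v (Suc k) i) / 2" if "k < K" "i < N" for k i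
    using that v[of k i] by (simp add: G_def lam_def y_def p_def q_def)
  have F_rod': "F (False, Suc k, b (Suc k) i) = - F (False, Suc k, i)" if "k < K" "i < N" for k i
    using that b kap by (simp add: F_def lam_def x_def p_def q_def algebra_simps)
  have G_rod': "G (False, Suc k, b (Suc k) i) = - G (False, Suc k, i)" if "k < K" "i < N" for k i
    using that b kap by (simp add: G_def lam_def y_def p_def q_def algebra_simps)
  have Suc_index: "\<exists>k i. z = (Suc k, i) \<and> k < K \<and> i < N" if "z \<in> {1..K} \<times> {..<N}" for z
    using that by (intro exI[of _ "fst z - 1"] exI[of _ "snd z"]) auto
  let ?E = "pieces \<union> rods" and ?V = "{..Suc K} \<times> {..<N}"
  \<comment> \<open>Only the first and last pieces, the rays, can reach beyond the strip.\<close>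
  let ?I = "{1..K} \<times> {..<N}" and ?S = "{True} \<times> {0, K} \<times> {..<N}"
  have out: "{e. e \<in> ?E \<and> p e = (Suc k, i)} = {(True, Suc k, i), (False, Suc k, i)}"
    if "k < K" "i < N" for k i
    using that by (auto simp: p_def pieces_def rods_def)
  have ins: "{e. e \<in> ?E \<and> q e = (Suc k, i)} = {(True, k, i), (False, Suc k, b (Suc k) i)}"
    if "k < K" "i < N" for k i
  proof -
    have "k' = k \<and> j = b (Suc k) i" if "k' < K" "j < N" "Suc k' = Suc k" "b (Suc k') j = i" for k' j
      using that b by auto
    then show ?thesis
      using that b by (auto simp: q_def pieces_def rods_def)
  qed
  have balance: "(\<Sum>e | e \<in> ?E \<and> p e = (k, i). H e) = (\<Sum>e | e \<in> ?E \<and> q e = (k, i). H e)"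
    if ki: "(k, i) \<in> ?V" "A < x (k, i)" "x (k, i) < B"
      and in_out: "\<And>k i. k < K \<Longrightarrow> i < N \<Longrightarrow> H (True, Suc k, i) + H (False, Suc k, i)
        = H (True, k, i) - H (False, Suc k, i)"
      and anti: "\<And>k i. k < K \<Longrightarrow> i < N \<Longrightarrow> H (False, Suc k, b (Suc k) i) = - H (False, Suc k, i)"
      and zero: "\<And>k i. k \<le> K \<Longrightarrow> i < N \<Longrightarrow> u k i = 0 \<Longrightarrow> H (True, k, i) = 0"
    for k i and H :: "bool \<times> nat \<times> nat \<Rightarrow> real"
  proof -
    have i: "i < N" "k \<le> Suc K" using ki by auto
    consider "k = 0" | "k = Suc K" | j where "k = Suc j" "j < K"
      using i(2) by (metis Suc_le_eq le_Suc_eq not0_implies_Suc)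
    then show ?thesis
    proof cases
      case 1
      \<comment> \<open>An artificial end inside the strip belongs to a ray with
        \<open>u = 0\<close>, so its only edge carries no force.\<close>
      have "u 0 i = 0" using outside(1)[of i] ki i 1 by (auto simp: x_def)
      moreover have ends: "{e. e \<in> ?E \<and> p e = (k, i)} = {(True, 0, i)}" "{e. e \<in> ?E \<and> q e = (k, i)} = {}"
        using i 1 by (auto simp: p_def q_def pieces_def rods_def)
      ultimately show ?thesis unfolding ends using zero i by simp
    next
      case 2
      have "u K i = 0" using outside(2)[of i] ki i 2 by (auto simp: x_def)
      moreover have ends: "{e. e \<in> ?E \<and> p e = (k, i)} = {}" "{e. e \<in> ?E \<and> q e = (k, i)} = {(True, K, i)}"
        using i 2 by (auto simp: p_def q_def pieces_def rods_def)
      ultimately show ?thesis unfolding ends using zero i by simp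
    next
      case 3
      then show ?thesis using out[of j i] ins[of j i] in_out[of j i] anti[of j i] i by simp
    qed
  qed
  have sum_S: "(\<Sum>e\<in>?S. H e) = (\<Sum>i<N. H (True, 0, i) + H (True, K, i))"
    for H :: "bool \<times> nat \<times> nat \<Rightarrow> real"
  proof -
    have "?S = (\<lambda>i. (True, 0, i)) ` {..<N} \<union> (\<lambda>i. (True, K, i)) ` {..<N}" by auto
    then show ?thesis
      using K by (simp only: sum.distrib, subst sum.union_disjoint) (auto simp: sum.reindex inj_on_def)
  qed
  \<comment> \<open>The halved rod carries half of the velocity jump, so its wedge with either
    adjacent piece is half the wedge of the two pieces. This half is the common lower bound for the
    three pairs.\<close>
  define w where "w = (\<lambda>(k, i). \<bar>u (k - 1) i * v k i - v (k - 1) i * u k i\<bar> / 2)"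
  have "(\<Sum>z\<in>?I. w z) \<le> 2 * (\<Sum>e\<in>?S. \<bar>F e\<bar>) * (\<Sum>e\<in>?S. \<bar>G e\<bar>)"
  proof (rule stress_graph_bound[where E = ?E and V = ?V and p = p and q = q and lam = lam
        and x = x and y = y and A = A and B = B])
    show "finite ?E" "finite ?V" by (simp_all add: pieces_def rods_def)
    show "p e \<in> ?V" if "e \<in> ?E" for e using that by (auto simp: p_def pieces_def rods_def)
    show "q e \<in> ?V" if "e \<in> ?E" for e
    proof -
      have "b k i < N" if "1 \<le> k" "k \<le> K" "i < N" for k i using that b(1)[of "k - 1" i] by simp
      then show ?thesis using that by (auto simp: q_def pieces_def rods_def)
    qed
    show "0 \<le> lam e" if "e \<in> ?E" for e
    proof -
      have "0 \<le> kap k i" if "1 \<le> k" "k \<le> K" "i < N" for k i using that kap(1)[of "k - 1" i] by simp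
      then show ?thesis using that tau
        by (auto simp: lam_def pieces_def rods_def less_imp_le)
    qed
    show "F e = lam e * (x (q e) - x (p e))" "G e = lam e * (y (q e) - y (p e))" for e
      by (simp_all add: F_def G_def)
    show "G e = 0" if e: "e \<in> ?E" "F e = 0" for e
    proof -
      consider k i where "e = (True, k, i)" "k \<le> K" "i < N" | k i where "e = (False, Suc k, i)" "k < K" "i < N"
        using e(1) Suc_index[of "snd e"] unfolding pieces_def rods_def by fastforce
      then show ?thesis
      proof cases
        case 1
        then show ?thesis using e(2) gen(1) by (simp add: F_piece G_piece)
      next
        case 2
        then show ?thesis using e(2) gen(2)[of k i] by (auto simp: F_def G_def lam_def x_def y_def p_def q_def)
      qed
    qed
    show "(\<Sum>e | e \<in> ?E \<and> p e = z. F e) = (\<Sum>e | e \<in> ?E \<and> q e = z. F e)"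
      if "z \<in> ?V" "A < x z" "x z < B" for z
    proof (cases z)
      case (Pair k i)
      show ?thesis using that unfolding Pair
        by (rule balance) (simp_all add: F_rod' F_rod F_piece field_simps)
    qed
    show "(\<Sum>e | e \<in> ?E \<and> p e = z. G e) = (\<Sum>e | e \<in> ?E \<and> q e = z. G e)"
      if "z \<in> ?V" "A < x z" "x z < B" for z
    proof (cases z)
      case (Pair k i)
      show ?thesis using that unfolding Pair
        by (rule balance) (simp_all add: G_rod' G_rod G_piece gen field_simps)
    qed
    show "A < B" by fact
    show "?S \<subseteq> ?E" by (auto simp: pieces_def)
    show "{x (p e), x (q e)} \<subseteq> {A<..<B}" if e: "e \<in> ?E - ?S" for e
    proof -
      have ins': "A < px k i" "px k i < B" if "1 \<le> k" "k \<le> K" "i < N" for k i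
        using that inside[of "k - 1" i] by auto
      have "b k i < N" if "1 \<le> k" "k \<le> K" "i < N" for k i using that b(1)[of "k - 1" i] by simp
      then show ?thesis using e ins' by (auto simp: x_def p_def q_def pieces_def rods_def)
    qed
    show "?I \<subseteq> ?V" by auto
    show "A < x z \<and> x z < B" if z_in: "z \<in> ?I" for z
    proof -
      obtain k i where "z = (Suc k, i)" "k < K" "i < N"
        using Suc_index[OF z_in] by blast
      then show ?thesis using inside by (simp add: x_def)
    qed
    show "\<exists>e\<in>?E. \<exists>f\<in>?E. \<exists>g\<in>?E. e \<noteq> f \<and> f \<noteq> g \<and> e \<noteq> g \<and>
      z \<in> {p e, q e} \<and> z \<in> {p f, q f} \<and> z \<in> {p g, q g} \<and>
      w z \<le> \<bar>F e * G f - G e * F f\<bar> \<and> w z \<le> \<bar>F f * G g - G f * F g\<bar> \<and>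
      w z \<le> \<bar>F e * G g - G e * F g\<bar>" if z_in: "z \<in> ?I" for z
    proof -
      obtain k i where z: "z = (Suc k, i)" "k < K" "i < N"
        using Suc_index[OF z_in] by blast
      let ?e = "(True, k, i)" and ?f = "(True, Suc k, i)" and ?g = "(False, Suc k, i)"
      have mem: "?e \<in> ?E" "?f \<in> ?E" "?g \<in> ?E" using z by (auto simp: pieces_def rods_def)
      have inc: "z \<in> {p ?e, q ?e}" "z \<in> {p ?f, q ?f}" "z \<in> {p ?g, q ?g}"
        using z by (auto simp: p_def q_def)
      have 1: "F ?e * G ?f - G ?e * F ?f = u k i * v (Suc k) i - v k i * u (Suc k) i"
        using z by (simp add: F_piece G_piece)
      have 2: "F ?f * G ?g - G ?f * F ?g = - (u k i * v (Suc k) i - v k i * u (Suc k) i) / 2"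
        using z by (simp add: F_piece G_piece F_rod G_rod field_simps)
      have 3: "F ?e * G ?g - G ?e * F ?g = - (u k i * v (Suc k) i - v k i * u (Suc k) i) / 2"
        using z by (simp add: F_piece G_piece F_rod G_rod field_simps)
      have wz: "w z = \<bar>u k i * v (Suc k) i - v k i * u (Suc k) i\<bar> / 2" using z by (simp add: w_def)
      show ?thesis
        by (intro bexI[of _ ?e] bexI[of _ ?f] bexI[of _ ?g] conjI mem inc, unfold 1 2 3 wz) auto
    qed
  qed
  also have "(\<Sum>e\<in>?S. \<bar>F e\<bar>) = (\<Sum>i<N. \<bar>u 0 i\<bar> + \<bar>u K i\<bar>)"
    unfolding sum_S by (simp add: F_piece)
  also have "(\<Sum>e\<in>?S. \<bar>G e\<bar>) = (\<Sum>i<N. \<bar>v 0 i\<bar> + \<bar>v K i\<bar>)"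
    unfolding sum_S by (simp add: G_piece)
  finally have main: "(\<Sum>z\<in>?I. w z) \<le> 2 * (\<Sum>i<N. \<bar>u 0 i\<bar> + \<bar>u K i\<bar>) * (\<Sum>i<N. \<bar>v 0 i\<bar> + \<bar>v K i\<bar>)" .
  have "(\<Sum>k<K. \<Sum>i<N. \<bar>u k i * v (Suc k) i - v k i * u (Suc k) i\<bar>)
      = (\<Sum>k\<in>{1..K}. \<Sum>i<N. 2 * w (k, i))"
    by (rule sum.reindex_bij_witness[of _ "\<lambda>k. k - 1" Suc]) (auto simp: w_def)
  also have "\<dots> = 2 * (\<Sum>z\<in>?I. w z)"
    by (simp add: sum.cartesian_product sum_distrib_left case_prod_unfold)
  finally show ?thesis using main by simp
qed

text \<open>The artificial end points are constructed here: the rays before the first and after the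
  last collision are cut at a large distance.\<close>

lemma planar_bound_sheared:
  fixes px py u v kap :: "nat \<Rightarrow> nat \<Rightarrow> real" and tau :: "nat \<Rightarrow> real" and b :: "nat \<Rightarrow> nat \<Rightarrow> nat"
  assumes tau: "\<And>k. Suc k < K \<Longrightarrow> tau (Suc k) > 0"
    and px: "\<And>k i. Suc k < K \<Longrightarrow> i < N \<Longrightarrow>
      px (Suc (Suc k)) i = px (Suc k) i + tau (Suc k) * u (Suc k) i"
    and py: "\<And>k i. Suc k < K \<Longrightarrow> i < N \<Longrightarrow>
      py (Suc (Suc k)) i = py (Suc k) i + tau (Suc k) * v (Suc k) i"
    and b: "\<And>k i. k < K \<Longrightarrow> i < N \<Longrightarrow> b (Suc k) i < N"
      "\<And>k i. k < K \<Longrightarrow> i < N \<Longrightarrow> b (Suc k) (b (Suc k) i) = i"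
    and kap: "\<And>k i. k < K \<Longrightarrow> i < N \<Longrightarrow> 0 \<le> kap (Suc k) i"
      "\<And>k i. k < K \<Longrightarrow> i < N \<Longrightarrow> kap (Suc k) (b (Suc k) i) = kap (Suc k) i"
    and u: "\<And>k i. k < K \<Longrightarrow> i < N \<Longrightarrow>
      u (Suc k) i = u k i - kap (Suc k) i * (px (Suc k) (b (Suc k) i) - px (Suc k) i)"
    and v: "\<And>k i. k < K \<Longrightarrow> i < N \<Longrightarrow>
      v (Suc k) i = v k i - kap (Suc k) i * (py (Suc k) (b (Suc k) i) - py (Suc k) i)"
    and gen: "\<And>k i. k \<le> K \<Longrightarrow> i < N \<Longrightarrow> u k i = 0 \<Longrightarrow> v k i = 0"
      "\<And>k i. k < K \<Longrightarrow> i < N \<Longrightarrow> px (Suc k) (b (Suc k) i) = px (Suc k) i \<Longrightarrow>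
        py (Suc k) (b (Suc k) i) = py (Suc k) i"
  shows "(\<Sum>k<K. \<Sum>i<N. \<bar>u k i * v (Suc k) i - v k i * u (Suc k) i\<bar>)
    \<le> 4 * (\<Sum>i<N. \<bar>u 0 i\<bar> + \<bar>u K i\<bar>) * (\<Sum>i<N. \<bar>v 0 i\<bar> + \<bar>v K i\<bar>)"
proof (cases "K = 0")
  case True
  then show ?thesis by (simp add: sum_nonneg)
next
  case False
  \<comment> \<open>\<open>B\<close> strictly exceeds all collision abscissas in absolute value. A
    ray of speed \<open>\<bar>u\<bar> > 0\<close> followed for time \<open>M\<close> covers at least
    \<open>2 * B\<close> and so ends outside the strip; where \<open>u = 0\<close>, division by zero
    gives 0 and \<open>M\<close> is not affected.\<close>
  define B where "B = 1 + (\<Sum>k<K. \<Sum>i<N. \<bar>px (Suc k) i\<bar>)"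
  define M where "M = 1 + (\<Sum>i<N. 2 * B / \<bar>u 0 i\<bar> + 2 * B / \<bar>u K i\<bar>)"
  have B: "\<bar>px (Suc k) i\<bar> < B" if "k < K" "i < N" for k i
  proof -
    have "\<bar>px (Suc k) i\<bar> \<le> (\<Sum>i<N. \<bar>px (Suc k) i\<bar>)"
      using that by (intro member_le_sum) auto
    also have "\<dots> \<le> (\<Sum>k<K. \<Sum>i<N. \<bar>px (Suc k) i\<bar>)"
      using that by (intro member_le_sum[where f = "\<lambda>k. \<Sum>i<N. \<bar>px (Suc k) i\<bar>"]) (auto intro: sum_nonneg)
    finally show ?thesis by (simp add: B_def)
  qed
  have B_pos: "B > 0" unfolding B_def by (intro add_pos_nonneg sum_nonneg) auto
  have M_ge: "2 * B / \<bar>u 0 i\<bar> + 2 * B / \<bar>u K i\<bar> < M" if "i < N" for i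
  proof -
    have "2 * B / \<bar>u 0 i\<bar> + 2 * B / \<bar>u K i\<bar> \<le> (\<Sum>i<N. 2 * B / \<bar>u 0 i\<bar> + 2 * B / \<bar>u K i\<bar>)"
      using that B_pos by (intro member_le_sum[where f = "\<lambda>i. 2 * B / \<bar>u 0 i\<bar> + 2 * B / \<bar>u K i\<bar>"]) auto
    then show ?thesis by (simp add: M_def)
  qed
  have M_pos: "M > 0" unfolding M_def using B_pos by (intro add_pos_nonneg sum_nonneg) auto
  have far: "B \<le> \<bar>M * c\<bar> - B" if "c \<noteq> 0" "2 * B / \<bar>c\<bar> \<le> M" for c
    using that M_pos by (simp add: pos_divide_le_eq abs_mult)
  define px' where "px' k i = (if k = 0 then px 1 i - M * u 0 i
    else if k = Suc K then px K i + M * u K i else px k i)" for k i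
  define py' where "py' k i = (if k = 0 then py 1 i - M * v 0 i
    else if k = Suc K then py K i + M * v K i else py k i)" for k i
  define tau' where "tau' k = (if k = 0 \<or> k = K then M else tau k)" for k
  have mid: "k = 0 \<or> k = K \<or> (\<exists>j. k = Suc j \<and> Suc j < K)" if "k \<le> K" for k
    using that by (cases k) auto
  show ?thesis
  proof (rule planar_bound_generic[where px = px' and py = py' and tau = tau' and kap = kap
        and b = b and A = "- B" and B = B])
    show "1 \<le> K" using False by simp
    show "0 < tau' k" if "k \<le> K" for k
      using mid[OF that] tau M_pos by (auto simp: tau'_def)
    show "px' (Suc k) i = px' k i + tau' k * u k i" if "k \<le> K" "i < N" for k i
      using mid[OF that(1)] that(2) px[of _ i] False by (auto simp: px'_def tau'_def)
    show "py' (Suc k) i = py' k i + tau' k * v k i" if "k \<le> K" "i < N" for k i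
      using mid[OF that(1)] that(2) py[of _ i] False by (auto simp: py'_def tau'_def)
    show "px' 0 i \<notin> {- B<..<B}" if "i < N" "u 0 i \<noteq> 0" for i
    proof -
      have "0 \<le> 2 * B / \<bar>u K i\<bar>" using B_pos by simp
      then have "2 * B / \<bar>u 0 i\<bar> \<le> M" using M_ge[OF that(1)] by linarith
      then show ?thesis
        using far[OF that(2)] B[of 0 i] that(1) False by (auto simp: px'_def)
    qed
    show "px' (Suc K) i \<notin> {- B<..<B}" if "i < N" "u K i \<noteq> 0" for i
    proof -
      have "0 \<le> 2 * B / \<bar>u 0 i\<bar>" using B_pos by simp
      then have "2 * B / \<bar>u K i\<bar> \<le> M" using M_ge[OF that(1)] by linarith
      then show ?thesis
        using far[OF that(2)] B[of "K - 1" i] that(1) False by (auto simp: px'_def)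
    qed
    show "- B < px' (Suc k) i \<and> px' (Suc k) i < B" if "k < K" "i < N" for k i
      using B[OF that] that by (auto simp: px'_def)
    show "- B < B" using B_pos by simp
  qed (use b kap u v gen in \<open>auto simp: px'_def py'_def\<close>)
qed

lemma planar_bound:
  fixes px py u v kap :: "nat \<Rightarrow> nat \<Rightarrow> real" and tau :: "nat \<Rightarrow> real" and b :: "nat \<Rightarrow> nat \<Rightarrow> nat"
  assumes tau: "\<And>k. Suc k < K \<Longrightarrow> tau (Suc k) > 0"
    and px: "\<And>k i. Suc k < K \<Longrightarrow> i < N \<Longrightarrow>
      px (Suc (Suc k)) i = px (Suc k) i + tau (Suc k) * u (Suc k) i"
    and py: "\<And>k i. Suc k < K \<Longrightarrow> i < N \<Longrightarrow>
      py (Suc (Suc k)) i = py (Suc k) i + tau (Suc k) * v (Suc k) i"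
    and b: "\<And>k i. k < K \<Longrightarrow> i < N \<Longrightarrow> b (Suc k) i < N"
      "\<And>k i. k < K \<Longrightarrow> i < N \<Longrightarrow> b (Suc k) (b (Suc k) i) = i"
    and kap: "\<And>k i. k < K \<Longrightarrow> i < N \<Longrightarrow> 0 \<le> kap (Suc k) i"
      "\<And>k i. k < K \<Longrightarrow> i < N \<Longrightarrow> kap (Suc k) (b (Suc k) i) = kap (Suc k) i"
    and u: "\<And>k i. k < K \<Longrightarrow> i < N \<Longrightarrow>
      u (Suc k) i = u k i - kap (Suc k) i * (px (Suc k) (b (Suc k) i) - px (Suc k) i)"
    and v: "\<And>k i. k < K \<Longrightarrow> i < N \<Longrightarrow>
      v (Suc k) i = v k i - kap (Suc k) i * (py (Suc k) (b (Suc k) i) - py (Suc k) i)"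
  shows "(\<Sum>k<K. \<Sum>i<N. \<bar>u k i * v (Suc k) i - v k i * u (Suc k) i\<bar>)
    \<le> 4 * (\<Sum>i<N. \<bar>u 0 i\<bar> + \<bar>u K i\<bar>) * (\<Sum>i<N. \<bar>v 0 i\<bar> + \<bar>v K i\<bar>)" (is "?S \<le> _")
proof -
  \<comment> \<open>A shear of the plane preserves the wedge products, and a generic one makes no edge vertical.\<close>
  define bad where "bad = (\<Union>k\<in>{..K}. \<Union>i\<in>{..<N}.
    {- u k i / v k i, - (px k (b k i) - px k i) / (py k (b k i) - py k i)})"
  define f where "f d = 4 * (\<Sum>i<N. \<bar>u 0 i + d * v 0 i\<bar> + \<bar>u K i + d * v K i\<bar>) * (\<Sum>i<N. \<bar>v 0 i\<bar> + \<bar>v K i\<bar>)"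
    for d
  have "?S \<le> f d" if d: "d \<notin> bad" for d
  proof -
    have nbad: "d \<noteq> - u k i / v k i" "d \<noteq> - (px k (b k i) - px k i) / (py k (b k i) - py k i)"
      if "k \<le> K" "i < N" for k i
      using that d by (auto simp: bad_def)
    have root: "w = 0" if "d \<noteq> - z / w" "z + d * w = 0" for z w
    proof (rule ccontr)
      assume "w \<noteq> 0"
      moreover have "d * w = - z" using that(2) by linarith
      ultimately have "d = - z / w" by (metis nonzero_mult_div_cancel_right)
      then show False using that(1) by contradiction
    qed
    have "(\<Sum>k<K. \<Sum>i<N. \<bar>(u k i + d * v k i) * v (Suc k) i - v k i * (u (Suc k) i + d * v (Suc k) i)\<bar>) \<le> f d"
      unfolding f_def
    proof (rule planar_bound_sheared[where px = "\<lambda>k i. px k i + d * py k i" and py = py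
          and tau = tau and kap = kap and b = b and u = "\<lambda>k i. u k i + d * v k i" and v = v])
      show "v k i = 0" if "k \<le> K" "i < N" "u k i + d * v k i = 0" for k i
        using root nbad(1) that by blast
      show "py (Suc k) (b (Suc k) i) = py (Suc k) i"
        if "k < K" "i < N" "px (Suc k) (b (Suc k) i) + d * py (Suc k) (b (Suc k) i) = px (Suc k) i + d * py (Suc k) i"
        for k i
        using root[OF nbad(2)[of "Suc k" i]] that by (auto simp: algebra_simps)
      show "u (Suc k) i + d * v (Suc k) i = u k i + d * v k i - kap (Suc k) i *
          (px (Suc k) (b (Suc k) i) + d * py (Suc k) (b (Suc k) i) - (px (Suc k) i + d * py (Suc k) i))"
        if "k < K" "i < N" for k i
        unfolding u[OF that] v[OF that] by (simp add: algebra_simps)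
      show "px (Suc (Suc k)) i + d * py (Suc (Suc k)) i = px (Suc k) i + d * py (Suc k) i
          + tau (Suc k) * (u (Suc k) i + d * v (Suc k) i)" if "Suc k < K" "i < N" for k i
        using px[OF that] py[OF that] by (simp add: algebra_simps)
    qed (use tau py b kap v in auto)
    moreover have "(u k i + d * v k i) * v (Suc k) i - v k i * (u (Suc k) i + d * v (Suc k) i)
        = u k i * v (Suc k) i - v k i * u (Suc k) i" for k i
      by (simp add: algebra_simps)
    ultimately show ?thesis by simp
  qed
  moreover have "\<forall>\<^sub>F d in at_right 0. d \<notin> bad"
  proof -
    have "finite bad" by (simp add: bad_def)
    then have "\<forall>\<^sub>F d in at_right 0. \<forall>c\<in>bad. d \<noteq> c"
      by (intro eventually_ball_finite) (auto intro: eventually_neq_at_within)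
    then show ?thesis by eventually_elim auto
  qed
  \<comment> \<open>All small positive shears are generic, and \<open>f\<close> is continuous, so
    the bound passes to the limit \<open>d = 0\<close>.\<close>
  ultimately have "\<forall>\<^sub>F d in at_right 0. ?S \<le> f d"
    by (auto elim: eventually_mono)
  moreover have "(f \<longlongrightarrow> f 0) (at_right 0)"
    unfolding f_def by (intro tendsto_intros)
  ultimately have "?S \<le> f 0"
    by (intro tendsto_lowerbound) auto
  then show ?thesis by (simp add: f_def)
qed

section \<open>Motions with binary collisions\<close>

text \<open>Lagrange's identity writes the squared area as half the sum of all squared 2 by 2 minors
  over ordered index pairs; the Euclidean norm is then at most the sum of absolute values.\<close>

lemma wedge_norm_le:
  fixes p q :: "real ^ 'n"
  shows "wedge_norm p q \<le> (\<Sum>k\<in>UNIV. \<Sum>l\<in>UNIV. \<bar>p $ k * q $ l - p $ l * q $ k\<bar>)"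
proof -
  let ?S = "\<Sum>k\<in>UNIV. \<Sum>l\<in>UNIV. \<bar>p $ k * q $ l - p $ l * q $ k\<bar>"
  have "(\<Sum>k\<in>UNIV. \<Sum>l\<in>UNIV. (p $ k * q $ l - p $ l * q $ k)\<^sup>2) = 2 * ((norm p)\<^sup>2 * (norm q)\<^sup>2 - (p \<bullet> q)\<^sup>2)"
  proof -
    have "(\<Sum>k\<in>UNIV. \<Sum>l\<in>UNIV. (p $ k * q $ l - p $ l * q $ k)\<^sup>2)
      = (\<Sum>k\<in>UNIV. \<Sum>l\<in>UNIV. (p $ k * p $ k) * (q $ l * q $ l) + (q $ k * q $ k) * (p $ l * p $ l)
          - 2 * ((p $ k * q $ k) * (p $ l * q $ l)))"
      by (intro sum.cong refl) (simp add: power2_eq_square algebra_simps)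
    also have "\<dots> = (p \<bullet> p) * (q \<bullet> q) + (q \<bullet> q) * (p \<bullet> p) - 2 * ((p \<bullet> q) * (p \<bullet> q))"
      unfolding sum.distrib sum_subtractf sum_distrib_left[symmetric] sum_distrib_right[symmetric]
      by (simp add: inner_vec_def)
    finally show ?thesis unfolding power2_norm_eq_inner by (simp add: power2_eq_square)
  qed
  then have "(norm p)\<^sup>2 * (norm q)\<^sup>2 - (p \<bullet> q)\<^sup>2
      \<le> (\<Sum>z\<in>UNIV. (case z of (k, l) \<Rightarrow> p $ k * q $ l - p $ l * q $ k)\<^sup>2)"
    using sum_nonneg[of UNIV "\<lambda>k. \<Sum>l\<in>UNIV. (p $ k * q $ l - p $ l * q $ k)\<^sup>2"]
    by (simp add: sum.cartesian_product sum_nonneg case_prod_unfold)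
  then have "wedge_norm p q \<le> L2_set (\<lambda>z. case z of (k, l) \<Rightarrow> p $ k * q $ l - p $ l * q $ k) UNIV"
    unfolding wedge_norm_def L2_set_def by (rule real_sqrt_le_mono)
  also have "\<dots> \<le> (\<Sum>z\<in>UNIV. \<bar>case z of (k, l) \<Rightarrow> p $ k * q $ l - p $ l * q $ k\<bar>)"
    by (rule L2_set_le_sum_abs)
  also have "\<dots> = ?S"
    by (simp add: sum.cartesian_product case_prod_unfold)
  finally show ?thesis .
qed

lemma sum_infsum_ennreal:
  fixes g :: "nat \<Rightarrow> 'b \<Rightarrow> ennreal"
  shows "(\<Sum>i<n. infsum (g i) X) = (\<Sum>\<^sub>\<infinity>t\<in>X. \<Sum>i<n. g i t)"
proof (induction n)
  case (Suc n)
  have "(\<Sum>\<^sub>\<infinity>t\<in>X. (\<Sum>i<n. g i t) + g n t) = (\<Sum>\<^sub>\<infinity>t\<in>X. \<Sum>i<n. g i t) + infsum (g n) X"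
    by (intro infsum_add nonneg_summable_on_complete) auto
  then show ?case using Suc by simp
qed simp

locale binary_motion =
  fixes N :: nat and a :: real and y :: "nat \<Rightarrow> real \<Rightarrow> real ^ 'n::finite"
  assumes a_pos: "a > 0"
    and motion: "hard_sphere_motion N a y"
    and locally_finite: "locally_finite_collisions N a y"
    and binary: "only_binary_collisions N a y"
begin

section \<open>Free flights and isolated collision times\<close>

definition C :: "real set" where
  "C = (\<Union>i<N. collision_times N a y i)"

abbreviation va :: "nat \<Rightarrow> real \<Rightarrow> real ^ 'n" where "va i t \<equiv> vel_after (y i) t"
abbreviation vb :: "nat \<Rightarrow> real \<Rightarrow> real ^ 'n" where "vb i t \<equiv> vel_before (y i) t"

lemma finite_C: "finite {t \<in> C. t < r}"
proof (cases "r > 0")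
  case True
  let ?X = "{(i, j, t). i < N \<and> j < N \<and> 0 < t \<and> t < r \<and> collide a y i j t}"
  have "finite ?X" using locally_finite True unfolding locally_finite_collisions_def by blast
  moreover have "{t \<in> C. t < r} \<subseteq> (\<lambda>(i, j, t). t) ` ?X"
    by (force simp: C_def collision_times_def)
  ultimately show ?thesis by (rule finite_surj)
next
  case False
  then have "{t \<in> C. t < r} = {}" by (auto simp: C_def collision_times_def)
  then show ?thesis by (simp only: finite.emptyI)
qed

lemma continuous_position: "i < N \<Longrightarrow> continuous_on {0<..} (y i)"
  and constant_velocity: "i < N \<Longrightarrow> 0 \<le> s \<Longrightarrow> s < u \<Longrightarrow> {s<..<u} \<inter> collision_times N a y i = {} \<Longrightarrow>
    \<exists>V. \<forall>t\<in>{s<..<u}. (y i has_vector_derivative V) (at t)"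
  and elastic: "i < N \<Longrightarrow> j < N \<Longrightarrow> t > 0 \<Longrightarrow> collide a y i j t \<Longrightarrow> elastic_law y i j t"
proof -
  note unfolded = motion[unfolded hard_sphere_motion_def]
  show "i < N \<Longrightarrow> continuous_on {0<..} (y i)"
    using unfolded by (elim conjE) simp
  show "i < N \<Longrightarrow> 0 \<le> s \<Longrightarrow> s < u \<Longrightarrow> {s<..<u} \<inter> collision_times N a y i = {} \<Longrightarrow>
    \<exists>V. \<forall>t\<in>{s<..<u}. (y i has_vector_derivative V) (at t)"
    using unfolded[THEN conjunct2, THEN conjunct2, THEN conjunct1, rule_format] .
  show "i < N \<Longrightarrow> j < N \<Longrightarrow> t > 0 \<Longrightarrow> collide a y i j t \<Longrightarrow> elastic_law y i j t"
    using unfolded[THEN conjunct2, THEN conjunct2, THEN conjunct2, rule_format, of i j t]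
      binary[unfolded only_binary_collisions_def, rule_format, of i j t] by simp
qed

text \<open>Continuity carries the straight motion from the open interval to its end points, so the
  one-sided velocities there equal \<open>V\<close> even when an end is a collision time.\<close>

lemma free_flight:
  assumes i: "i < N" and s: "0 \<le> s" "s < u" and free: "{s<..<u} \<inter> collision_times N a y i = {}"
  shows "\<exists>V. (\<forall>r t. 0 < r \<and> s \<le> r \<and> r \<le> t \<and> t \<le> u \<longrightarrow> y i t = y i r + (t - r) *\<^sub>R V)
    \<and> (\<forall>t. 0 < t \<and> s \<le> t \<and> t < u \<longrightarrow> va i t = V) \<and> (\<forall>t. s < t \<and> t \<le> u \<longrightarrow> vb i t = V)"
proof -
  obtain V where V: "\<And>t. t \<in> {s<..<u} \<Longrightarrow> (y i has_vector_derivative V) (at t)"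
    using constant_velocity[OF i s free] by blast
  have line: "y i t = y i r + (t - r) *\<^sub>R V" if rt: "0 < r" "s \<le> r" "r \<le> t" "t \<le> u" for r t
  proof (cases "r = t")
    case False
    \<comment> \<open>Subtracting the uniform motion leaves zero derivative inside, and the mean
      value inequality needs only continuity at the ends.\<close>
    let ?g = "\<lambda>t. y i t - t *\<^sub>R V"
    have "continuous_on {r..t} ?g"
      using rt by (intro continuous_intros continuous_on_subset[OF continuous_position[OF i]]) auto
    moreover have "(?g has_derivative (\<lambda>h. 0)) (at z)" if "z \<in> {r<..<t}" for z
    proof -
      have "(?g has_vector_derivative V - 1 *\<^sub>R V) (at z)"
        using V[of z] that rt by (auto intro!: derivative_eq_intros)
      then show ?thesis by (simp add: has_vector_derivative_def)
    qed
    ultimately have "norm (?g t - ?g r) \<le> norm (0 :: real ^ 'n)"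
      using mvt_general[of r t ?g "\<lambda>z h. 0"] False rt by force
    then have "?g t = ?g r" by simp
    then show ?thesis by (simp add: algebra_simps)
  qed simp
  have va: "va i t = V" if t: "0 < t" "s \<le> t" "t < u" for t
  proof -
    have "((\<lambda>r. y i t + (r - t) *\<^sub>R V) has_vector_derivative V) (at t within {t..})"
      by (auto intro!: derivative_eq_intros)
    then have "(y i has_vector_derivative V) (at t within {t..})"
    proof (rule has_vector_derivative_transform_within[where d = "u - t"])
      fix r assume "r \<in> {t..}" "dist r t < u - t"
      then show "y i t + (r - t) *\<^sub>R V = y i r"
        using t line[of t r] by (simp add: dist_real_def)
    qed (use t in auto)
    then have "(y i has_vector_derivative V) (at_right t)"
      by (rule has_vector_derivative_within_subset) auto
    then show ?thesis unfolding vel_after_def by (intro vector_derivative_within) auto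
  qed
  have vb: "vb i t = V" if t: "s < t" "t \<le> u" for t
  proof -
    have "((\<lambda>r. y i t + (r - t) *\<^sub>R V) has_vector_derivative V) (at t within {..t})"
      by (auto intro!: derivative_eq_intros)
    then have "(y i has_vector_derivative V) (at t within {..t})"
    proof (rule has_vector_derivative_transform_within[where d = "t - s"])
      fix r assume "r \<in> {..t}" "dist r t < t - s"
      then show "y i t + (r - t) *\<^sub>R V = y i r"
        using t s line[of r t] by (simp add: dist_real_def algebra_simps)
    qed (use t in auto)
    then have "(y i has_vector_derivative V) (at_left t)"
      by (rule has_vector_derivative_within_subset) auto
    then show ?thesis unfolding vel_before_def by (intro vector_derivative_within) auto
  qed
  show ?thesis using line va vb by blast
qed

lemma isolated:
  assumes "t > 0"
  obtains s u where "0 \<le> s" "s < t" "t < u" "{s<..<t} \<inter> C = {}" "{t<..<u} \<inter> C = {}"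
proof -
  define X where "X = {c \<in> C. c < t + 1}"
  have X: "finite X" unfolding X_def by (rule finite_C)
  \<comment> \<open>The neighbouring collision times; \<open>0\<close> and \<open>t + 1\<close> are
    defaults when there is none in range.\<close>
  define s where "s = Max (insert 0 {c \<in> X. c < t})"
  define u where "u = Min (insert (t + 1) {c \<in> X. t < c})"
  have s: "s \<in> insert 0 {c \<in> X. c < t}" unfolding s_def using X by (intro Max_in) auto
  have u: "u \<in> insert (t + 1) {c \<in> X. t < c}" unfolding u_def using X by (intro Min_in) auto
  have s_ge: "c \<le> s" if "c \<in> insert 0 {c \<in> X. c < t}" for c
    unfolding s_def using X that by (intro Max_ge) auto
  have u_le: "u \<le> c" if "c \<in> insert (t + 1) {c \<in> X. t < c}" for c
    unfolding u_def using X that by (intro Min_le) auto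
  show ?thesis
  proof (rule that)
    show "0 \<le> s" using s_ge by simp
    show "s < t" using s assms by auto
    show "t < u" using u by auto
    show "{s<..<t} \<inter> C = {}"
    proof (intro equals0I)
      fix c assume "c \<in> {s<..<t} \<inter> C"
      then show False using s_ge[of c] by (auto simp: X_def)
    qed
    show "{t<..<u} \<inter> C = {}"
    proof (intro equals0I)
      fix c assume c: "c \<in> {t<..<u} \<inter> C"
      moreover have "u \<le> t + 1" using u_le by simp
      ultimately show False using u_le[of c] by (auto simp: X_def)
    qed
  qed
qed

text \<open>Other particles may collide at time \<open>t\<close>, but the path of \<open>i\<close>
  is straight across \<open>t\<close>, and a single free flight gives both one-sided
  velocities.\<close>

lemma no_jump:
  assumes "i < N" "t > 0" "t \<notin> collision_times N a y i"
  shows "va i t = vb i t"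
proof -
  obtain s u where su: "0 \<le> s" "s < t" "t < u" "{s<..<t} \<inter> C = {}" "{t<..<u} \<inter> C = {}"
    using isolated[OF assms(2)] by blast
  have "{s<..<u} \<inter> collision_times N a y i = {}"
  proof -
    have "{s<..<u} = {s<..<t} \<union> {t} \<union> {t<..<u}" using su by auto
    then show ?thesis using su(4,5) assms(1,3) by (auto simp: C_def)
  qed
  then obtain V where "\<forall>t. 0 < t \<and> s \<le> t \<and> t < u \<longrightarrow> va i t = V" "\<forall>t. s < t \<and> t \<le> u \<longrightarrow> vb i t = V"
    using free_flight[of i s u] su assms(1) by auto
  then show ?thesis using su assms(2) by auto
qed

section \<open>Impulses and conservation laws\<close>

lemma collide_sym: "collide a y i j t \<Longrightarrow> collide a y j i t"
  unfolding collide_def by (simp add: norm_minus_commute inner_diff_left inner_diff_right algebra_simps)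

text \<open>The normal relative velocity passes from negative to positive, so the impulse is
  repulsive; as the centers are at distance \<open>2 * a\<close>, its coefficient is determined by
  the norm of the velocity jump. This sign makes the rods carry a nonnegative stress.\<close>

lemma impulse:
  assumes "t > 0" "i < N" "j < N" "collide a y i j t"
  shows "va i t = vb i t - (norm (va i t - vb i t) / (2 * a)) *\<^sub>R (y j t - y i t)"
    and "va j t - vb j t = - (va i t - vb i t)"
    and "(norm (va j t))\<^sup>2 - (norm (vb j t))\<^sup>2 = - ((norm (va i t))\<^sup>2 - (norm (vb i t))\<^sup>2)"
proof -
  obtain k where sum: "va i t + va j t = vb i t + vb j t"
    and k: "va i t - vb i t = k *\<^sub>R (y j t - y i t)"
      "vb j t - va j t = k *\<^sub>R (y j t - y i t)"
    and E: "(norm (va i t))\<^sup>2 + (norm (va j t))\<^sup>2 = (norm (vb i t))\<^sup>2 + (norm (vb j t))\<^sup>2"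
    using elastic[OF assms(2,3,1,4)] unfolding elastic_law_def by blast
  let ?d = "y j t - y i t"
  have d: "norm ?d = 2 * a" and neg: "(vb j t - vb i t) \<bullet> ?d < 0" and pos: "(va j t - va i t) \<bullet> ?d > 0"
    using assms(4) unfolding collide_def by auto
  have "(va j t - va i t) - (vb j t - vb i t) = - (vb j t - va j t) - (va i t - vb i t)"
    by simp
  also have "\<dots> = - (k *\<^sub>R ?d) - k *\<^sub>R ?d"
    unfolding k ..
  also have "\<dots> = (- 2 * k) *\<^sub>R ?d"
    by (simp flip: scaleR_minus_left scaleR_left_diff_distrib)
  finally have jump: "(va j t - va i t) - (vb j t - vb i t) = (- 2 * k) *\<^sub>R ?d" .
  have "(va j t - va i t) \<bullet> ?d - (vb j t - vb i t) \<bullet> ?d = (- 2 * k) * (?d \<bullet> ?d)"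
    using arg_cong[OF jump, of "\<lambda>z. z \<bullet> ?d"] by (simp only: inner_diff_left inner_scaleR_left)
  then have "0 < (- 2 * k) * (?d \<bullet> ?d)" using neg pos by linarith
  then have "k < 0"
    using mult_nonpos_nonneg[of "- 2 * k" "?d \<bullet> ?d"] by fastforce
  then have coeff: "norm (va i t - vb i t) / (2 * a) = - k"
    using k(1) d a_pos by simp
  show "va i t = vb i t - (norm (va i t - vb i t) / (2 * a)) *\<^sub>R ?d"
    unfolding coeff using k(1) by (simp add: algebra_simps)
  show "va j t - vb j t = - (va i t - vb i t)"
    using sum by (simp add: algebra_simps)
  show "(norm (va j t))\<^sup>2 - (norm (vb j t))\<^sup>2 = - ((norm (va i t))\<^sup>2 - (norm (vb i t))\<^sup>2)"
    using E by linarith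
qed

text \<open>A particle that does not collide at \<open>t\<close> is its own partner. This makes
  \<open>partner t\<close> an involution of all particles, and such a particle gets a degenerate rod
  without force.\<close>

definition partner :: "real \<Rightarrow> nat \<Rightarrow> nat" where
  "partner t i = (if \<exists>j<N. collide a y i j t then (SOME j. j < N \<and> collide a y i j t) else i)"

definition kap :: "real \<Rightarrow> nat \<Rightarrow> real" where
  "kap t i = norm (va i t - vb i t) / (2 * a)"

lemma partner_cases:
  assumes "t > 0" "i < N"
  obtains (collision) j where "j < N" "collide a y i j t" "partner t i = j" "partner t j = i"
    | (free) "partner t i = i" "va i t = vb i t"
proof (cases "\<exists>j<N. collide a y i j t")
  case True
  \<comment> \<open>Binarity leaves a single candidate, so the choice operator returns it.\<close>
  have partner_eq: "partner t k = l" if "k < N" "l < N" "collide a y k l t" for k l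
  proof -
    have unique: "k' = l" if "k' < N" "collide a y k k' t" for k'
      using binary assms(1) \<open>k < N\<close> \<open>l < N\<close> \<open>collide a y k l t\<close> that
      unfolding only_binary_collisions_def binary_collision_def by blast
    have "(SOME j. j < N \<and> collide a y k j t) = l"
      by (rule some_equality) (use unique \<open>l < N\<close> \<open>collide a y k l t\<close> in blast)+
    moreover have "\<exists>j<N. collide a y k j t" using \<open>l < N\<close> \<open>collide a y k l t\<close> by blast
    ultimately show ?thesis by (simp only: partner_def if_True simp_thms)
  qed
  obtain j where j: "j < N" "collide a y i j t" using True by blast
  show ?thesis
    using collision[OF j partner_eq[OF assms(2) j]] partner_eq[OF j(1) assms(2) collide_sym[OF j(2)]]
    by simp
next
  case False
  then have "t \<notin> collision_times N a y i" by (auto simp: collision_times_def)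
  then show ?thesis using free False no_jump assms by (auto simp: partner_def)
qed

lemma partner_props:
  assumes "t > 0" "i < N"
  shows "partner t i < N" "partner t (partner t i) = i" "kap t (partner t i) = kap t i"
    "va i t = vb i t - kap t i *\<^sub>R (y (partner t i) t - y i t)"
    "va (partner t i) t - vb (partner t i) t = - (va i t - vb i t)"
    "(norm (va (partner t i) t))\<^sup>2 - (norm (vb (partner t i) t))\<^sup>2 = - ((norm (va i t))\<^sup>2 - (norm (vb i t))\<^sup>2)"
proof -
  consider j where "j < N" "collide a y i j t" "partner t i = j" "partner t j = i"
    | "partner t i = i" "va i t = vb i t"
    using partner_cases[OF assms] by blast
  then have "partner t i < N \<and> partner t (partner t i) = i \<and> kap t (partner t i) = kap t i \<and>
    va i t = vb i t - kap t i *\<^sub>R (y (partner t i) t - y i t) \<and>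
    va (partner t i) t - vb (partner t i) t = - (va i t - vb i t) \<and>
    (norm (va (partner t i) t))\<^sup>2 - (norm (vb (partner t i) t))\<^sup>2 = - ((norm (va i t))\<^sup>2 - (norm (vb i t))\<^sup>2)"
  proof cases
    case 1
    note imp = impulse[OF assms 1(1,2)]
    have "kap t j = kap t i" unfolding kap_def imp(2) norm_minus_cancel ..
    then show ?thesis using 1 imp by (simp add: kap_def)
  next
    case 2
    then show ?thesis using assms by (simp add: kap_def)
  qed
  then show "partner t i < N" "partner t (partner t i) = i" "kap t (partner t i) = kap t i"
    "va i t = vb i t - kap t i *\<^sub>R (y (partner t i) t - y i t)"
    "va (partner t i) t - vb (partner t i) t = - (va i t - vb i t)"
    "(norm (va (partner t i) t))\<^sup>2 - (norm (vb (partner t i) t))\<^sup>2 = - ((norm (va i t))\<^sup>2 - (norm (vb i t))\<^sup>2)"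
    by blast+
qed

text \<open>Reindexing by the involution \<open>partner t\<close> turns the sum into its own
  negative.\<close>

lemma sum_antisymmetric:
  fixes g :: "nat \<Rightarrow> 'b::real_vector"
  assumes "t > 0" "\<And>i. i < N \<Longrightarrow> g (partner t i) = - g i"
  shows "(\<Sum>i<N. g i) = 0"
proof -
  have "(\<Sum>i<N. g i) = (\<Sum>i<N. g (partner t i))"
    using partner_props(1,2)[OF assms(1)]
    by (intro sum.reindex_bij_witness[of _ "partner t" "partner t"]) auto
  also have "\<dots> = - (\<Sum>i<N. g i)" using assms(2) by (simp add: sum_negf)
  finally show ?thesis by (simp add: eq_neg_iff_add_eq_0 flip: scaleR_2)
qed

lemma momentum_jump: "t > 0 \<Longrightarrow> (\<Sum>i<N. vb i t) = (\<Sum>i<N. va i t)"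
  using sum_antisymmetric[of t "\<lambda>i. va i t - vb i t"] partner_props(5) by (simp add: sum_subtractf)

lemma energy_jump: "t > 0 \<Longrightarrow> (\<Sum>i<N. (norm (vb i t))\<^sup>2) = (\<Sum>i<N. (norm (va i t))\<^sup>2)"
  using sum_antisymmetric[of t "\<lambda>i. (norm (va i t))\<^sup>2 - (norm (vb i t))\<^sup>2"] partner_props(6)
  by (simp add: sum_subtractf)

text \<open>The sum is locally constant on the connected half-line: velocities are constant near
  \<open>t\<close> on either side, and \<open>jump\<close> glues the two sides.\<close>

lemma conserved:
  fixes \<phi> :: "real ^ 'n \<Rightarrow> 'b::real_vector"
  assumes jump: "\<And>t. t > 0 \<Longrightarrow> (\<Sum>i<N. \<phi> (vb i t)) = (\<Sum>i<N. \<phi> (va i t))"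
    and "r > 0" "t > 0"
  shows "(\<Sum>i<N. \<phi> (va i r)) = (\<Sum>i<N. \<phi> (va i t))"
proof (rule connected_local_const[of "{0<..}"])
  show "\<forall>t\<in>{0<..}. \<forall>\<^sub>F r in at t within {0<..}. (\<Sum>i<N. \<phi> (va i t)) = (\<Sum>i<N. \<phi> (va i r))"
  proof
    fix t :: real assume "t \<in> {0<..}"
    then have t: "t > 0" by simp
    obtain s u where su: "0 \<le> s" "s < t" "t < u" "{s<..<t} \<inter> C = {}" "{t<..<u} \<inter> C = {}"
      using isolated[OF t] by blast
    have after: "va i r = va i t" if h: "i < N" "t < r" "r < u" for i r
    proof -
      have free: "{t<..<u} \<inter> collision_times N a y i = {}" using su(5) h(1) by (auto simp: C_def)
      obtain V where "\<forall>r. 0 < r \<and> t \<le> r \<and> r < u \<longrightarrow> va i r = V"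
        using free_flight[OF h(1) less_imp_le[OF t] su(3) free] by blast
      then show ?thesis using h t by auto
    qed
    have before: "va i r = vb i t" if h: "i < N" "s < r" "r < t" for i r
    proof -
      have free: "{s<..<t} \<inter> collision_times N a y i = {}" using su(4) h(1) by (auto simp: C_def)
      obtain V where "\<forall>r. 0 < r \<and> s \<le> r \<and> r < t \<longrightarrow> va i r = V" "\<forall>r. s < r \<and> r \<le> t \<longrightarrow> vb i r = V"
        using free_flight[OF h(1) su(1,2) free] by blast
      then show ?thesis using h su by auto
    qed
    have "(\<Sum>i<N. \<phi> (va i t)) = (\<Sum>i<N. \<phi> (va i r))" if "r \<in> {s<..<u}" "r \<noteq> t" for r
    proof (cases "t < r")
      case True
      then show ?thesis using after that by (intro sum.cong) auto
    next
      case False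
      then have "(\<Sum>i<N. \<phi> (va i r)) = (\<Sum>i<N. \<phi> (vb i t))"
        using before that by (intro sum.cong) auto
      then show ?thesis using jump[OF t] by simp
    qed
    then show "\<forall>\<^sub>F r in at t within {0<..}. (\<Sum>i<N. \<phi> (va i t)) = (\<Sum>i<N. \<phi> (va i r))"
      unfolding eventually_at_topological using su by (intro exI[of _ "{s<..<u}"]) auto
  qed
qed (use assms in auto)

section \<open>Projecting the motion to planar frameworks\<close>

text \<open>The linear functionals \<open>c * t + y \<bullet> e\<close> and
  \<open>d * t + y \<bullet> f\<close> project space-time to a plane. Only collisions before
  \<open>r\<close> are used, so the framework is finite; \<open>t1\<close> and \<open>t2\<close> are
  the first and last of these times if there are any.\<close>

lemma planar_hodograph_bound:
  fixes c d :: real and e f :: "real ^ 'n"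
  shows "\<exists>t1>0. \<exists>t2>0.
    (\<Sum>t | t \<in> C \<and> t < r. \<Sum>i<N. \<bar>(c + vb i t \<bullet> e) * (d + va i t \<bullet> f) - (d + vb i t \<bullet> f) * (c + va i t \<bullet> e)\<bar>)
    \<le> 4 * (\<Sum>i<N. \<bar>c + vb i t1 \<bullet> e\<bar> + \<bar>c + va i t2 \<bullet> e\<bar>) * (\<Sum>i<N. \<bar>d + vb i t1 \<bullet> f\<bar> + \<bar>d + va i t2 \<bullet> f\<bar>)"
proof -
  define T where "T = {t \<in> C. t < r}"
  have fin: "finite T" unfolding T_def by (rule finite_C)
  define l where "l = sorted_list_of_set T"
  define K where "K = length l"
  \<comment> \<open>The velocity after the \<open>k\<close>-th collision time, counted from 1, and
    before all of them for \<open>k = 0\<close>; the list counts from 0, whence the shift.\<close>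
  define W where "W k i = (if k = 0 then vb i (l ! 0) else va i (l ! (k - 1)))" for k i
  have set_l: "set l = T" unfolding l_def using fin by simp
  have l_in: "l ! k \<in> T" if "k < K" for k
    using nth_mem[of k l] that by (simp add: set_l K_def)
  have l_pos: "0 < l ! k" if "k < K" for k
    using l_in[OF that] by (auto simp: T_def C_def collision_times_def)
  have l_less: "l ! j < l ! k" if "j < k" "k < K" for j k
    using that strict_sorted_list_of_set[of T] unfolding l_def K_def by (simp add: sorted_wrt_nth_less)
  have flight: "y i (l ! Suc k) = y i (l ! k) + (l ! Suc k - l ! k) *\<^sub>R va i (l ! k) \<and>
      vb i (l ! Suc k) = va i (l ! k)" if k: "Suc k < K" "i < N" for k i
  proof -
    have gap: "l ! k < l ! Suc k" using l_less k by simp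
    have free: "{l ! k<..<l ! Suc k} \<inter> collision_times N a y i = {}"
    proof (intro equals0I)
      fix t assume t: "t \<in> {l ! k<..<l ! Suc k} \<inter> collision_times N a y i"
      then have "t \<in> T" using l_in[OF k(1)] k(2) by (auto simp: T_def C_def)
      then obtain j where j: "j < K" "t = l ! j" using set_l by (auto simp: in_set_conv_nth K_def)
      have "j \<le> k \<or> Suc k \<le> j" by linarith
      then show False using j t l_less[of j k] l_less[of "Suc k" j] k
        by (auto simp: le_less)
    qed
    have pos: "0 < l ! k" using l_pos k by simp
    obtain V where V: "\<forall>p t. 0 < p \<and> l ! k \<le> p \<and> p \<le> t \<and> t \<le> l ! Suc k \<longrightarrow> y i t = y i p + (t - p) *\<^sub>R V"
      "\<forall>t. 0 < t \<and> l ! k \<le> t \<and> t < l ! Suc k \<longrightarrow> va i t = V"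
      "\<forall>t. l ! k < t \<and> t \<le> l ! Suc k \<longrightarrow> vb i t = V"
      using free_flight[OF k(2) less_imp_le[OF pos] gap free] by blast
    have "va i (l ! k) = V" using V(2) gap pos by blast
    moreover have "vb i (l ! Suc k) = V" using V(3) gap by blast
    moreover have "y i (l ! Suc k) = y i (l ! k) + (l ! Suc k - l ! k) *\<^sub>R V"
      using V(1) gap pos by (meson less_imp_le order_refl)
    ultimately show ?thesis by simp
  qed
  have W_Suc: "W (Suc k) i = va i (l ! k)" for k i by (simp add: W_def)
  have W_before: "W k i = vb i (l ! k)" if "k < K" "i < N" for k i
    using that flight[of "k - 1" i] by (cases k) (auto simp: W_def)
  have jump: "W (Suc k) i = W k i - kap (l ! k) i *\<^sub>R (y (partner (l ! k) i) (l ! k) - y i (l ! k))"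
    if "k < K" "i < N" for k i
    using partner_props(4)[OF l_pos[OF that(1)] that(2)] by (simp only: W_Suc W_before[OF that])
  let ?p = "\<lambda>c e k i. c * l ! (k - 1) + y i (l ! (k - 1)) \<bullet> e"
  have line: "?p c e (Suc (Suc k)) i = ?p c e (Suc k) i + (l ! Suc k - l ! k) * (c + W (Suc k) i \<bullet> e)"
    if "Suc k < K" "i < N" for k i c e
    by (simp add: W_Suc flight[OF that, THEN conjunct1] inner_add_left algebra_simps)
  have jump': "c + W (Suc k) i \<bullet> e = c + W k i \<bullet> e
      - kap (l ! k) i * (?p c e (Suc k) (partner (l ! k) i) - ?p c e (Suc k) i)"
    if "k < K" "i < N" for k i c e
    unfolding jump[OF that] by (simp add: inner_diff_left)
  have planar: "(\<Sum>k<K. \<Sum>i<N. \<bar>(c + W k i \<bullet> e) * (d + W (Suc k) i \<bullet> f) - (d + W k i \<bullet> f) * (c + W (Suc k) i \<bullet> e)\<bar>)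
    \<le> 4 * (\<Sum>i<N. \<bar>c + W 0 i \<bullet> e\<bar> + \<bar>c + W K i \<bullet> e\<bar>) * (\<Sum>i<N. \<bar>d + W 0 i \<bullet> f\<bar> + \<bar>d + W K i \<bullet> f\<bar>)"
  proof (rule planar_bound[where px = "?p c e" and py = "?p d f" and tau = "\<lambda>k. l ! k - l ! (k - 1)"
        and b = "\<lambda>k. partner (l ! (k - 1))" and kap = "\<lambda>k. kap (l ! (k - 1))"])
    show "0 < l ! Suc k - l ! (Suc k - 1)" if "Suc k < K" for k using l_less[of k "Suc k"] that by simp
    show "0 \<le> kap (l ! (Suc k - 1)) i" for k i using a_pos by (simp add: kap_def)
    show "?p c e (Suc (Suc k)) i = ?p c e (Suc k) i + (l ! Suc k - l ! (Suc k - 1)) * (c + W (Suc k) i \<bullet> e)"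
      "?p d f (Suc (Suc k)) i = ?p d f (Suc k) i + (l ! Suc k - l ! (Suc k - 1)) * (d + W (Suc k) i \<bullet> f)"
      if "Suc k < K" "i < N" for k i
      using line[OF that, of c e] line[OF that, of d f] by simp_all
    show "partner (l ! (Suc k - 1)) i < N"
      "partner (l ! (Suc k - 1)) (partner (l ! (Suc k - 1)) i) = i"
      "kap (l ! (Suc k - 1)) (partner (l ! (Suc k - 1)) i) = kap (l ! (Suc k - 1)) i"
      if "k < K" "i < N" for k i
      using partner_props(1-3)[OF l_pos[OF that(1)] that(2)] by simp_all
    show "c + W (Suc k) i \<bullet> e = c + W k i \<bullet> e - kap (l ! (Suc k - 1)) i *
        (?p c e (Suc k) (partner (l ! (Suc k - 1)) i) - ?p c e (Suc k) i)"
      "d + W (Suc k) i \<bullet> f = d + W k i \<bullet> f - kap (l ! (Suc k - 1)) i *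
        (?p d f (Suc k) (partner (l ! (Suc k - 1)) i) - ?p d f (Suc k) i)"
      if "k < K" "i < N" for k i
      using jump'[OF that, of c e] jump'[OF that, of d f] by simp_all
  qed
  have bij: "bij_betw ((!) l) {..<K} T"
    by (intro bij_betw_nth) (simp_all add: l_def distinct_sorted_list_of_set K_def set_l[unfolded l_def])
  have eq: "(\<Sum>t\<in>T. \<Sum>i<N. \<bar>(c + vb i t \<bullet> e) * (d + va i t \<bullet> f) - (d + vb i t \<bullet> f) * (c + va i t \<bullet> e)\<bar>)
      = (\<Sum>k<K. \<Sum>i<N. \<bar>(c + W k i \<bullet> e) * (d + W (Suc k) i \<bullet> f) - (d + W k i \<bullet> f) * (c + W (Suc k) i \<bullet> e)\<bar>)"
    by (subst sum.reindex_bij_betw[OF bij, symmetric], intro sum.cong refl) (simp add: W_Suc W_before)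
  show ?thesis
  proof (cases "K = 0")
    case True
    then have "T = {}" using set_l by (simp add: K_def)
    then show ?thesis unfolding T_def[symmetric]
      by (intro exI[of _ 1] conjI) (auto intro!: mult_nonneg_nonneg sum_nonneg)
  next
    case False
    then have "W K i = va i (l ! (K - 1))" for i by (simp add: W_def)
    moreover have "W 0 i = vb i (l ! 0)" for i by (simp add: W_def)
    ultimately show ?thesis
      using planar False l_pos[of 0] l_pos[of "K - 1"] unfolding T_def[symmetric] eq
      by (intro exI[of _ "l ! 0"] exI[of _ "l ! (K - 1)"] conjI) auto
  qed
qed

section \<open>Velocity deviations and the truncated bounds\<close>

lemma sum_dev_expand:
  fixes z :: "nat \<Rightarrow> real ^ 'n"
  shows "(\<Sum>i<N. (norm (z i - w))\<^sup>2) = (\<Sum>i<N. (norm (z i))\<^sup>2) - 2 * ((\<Sum>i<N. z i) \<bullet> w) + real N * (norm w)\<^sup>2"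
proof -
  have "(norm (z i - w))\<^sup>2 = (norm (z i))\<^sup>2 - 2 * (z i \<bullet> w) + (norm w)\<^sup>2" for i
    by (simp add: power2_norm_eq_inner inner_diff_left inner_diff_right inner_commute algebra_simps)
  then show ?thesis
    by (simp add: sum.distrib sum_subtractf sum_distrib_left inner_sum_left)
qed

lemma sum_dev_mean:
  assumes "N > 0"
  shows "(\<Sum>i<N. (norm (va i t0 - mean_velocity N y t0))\<^sup>2)
    = real N * ((rms_velocity N y t0)\<^sup>2 - (norm (mean_velocity N y t0))\<^sup>2)"
proof -
  have mom: "(\<Sum>i<N. va i t0) = real N *\<^sub>R mean_velocity N y t0"
    using assms by (simp add: mean_velocity_def)
  have rms: "real N * (rms_velocity N y t0)\<^sup>2 = (\<Sum>i<N. (norm (va i t0))\<^sup>2)"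
    using assms by (simp add: rms_velocity_def energy_def sum_nonneg sum_divide_distrib[symmetric])
  show ?thesis
    unfolding sum_dev_expand mom rms[symmetric] by (simp add: power2_norm_eq_inner algebra_simps)
qed

text \<open>Ensures that squaring \<open>std_velocity\<close> recovers the expression under its
  root.\<close>

lemma variance_nonneg:
  assumes "N > 0"
  shows "0 \<le> (rms_velocity N y t0)\<^sup>2 - (norm (mean_velocity N y t0))\<^sup>2"
proof -
  have "0 \<le> (\<Sum>i<N. (norm (va i t0 - mean_velocity N y t0))\<^sup>2)"
    by (intro sum_nonneg) simp
  then show ?thesis
    unfolding sum_dev_mean[OF assms] using assms by (simp add: zero_le_mult_iff)
qed

lemma std_nonneg: "N > 0 \<Longrightarrow> 0 \<le> std_velocity N y t0"
  unfolding std_velocity_def using variance_nonneg by simp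

text \<open>After expansion about the fixed vector \<open>mean_velocity N y t0\<close>, only total
  momentum and energy depend on \<open>t\<close>, and both are conserved.\<close>

lemma sum_dev_squared:
  assumes "N > 0" "t0 > 0" "t > 0"
  shows "(\<Sum>i<N. (norm (va i t - mean_velocity N y t0))\<^sup>2) = real N * (std_velocity N y t0)\<^sup>2"
    and "(\<Sum>i<N. (norm (vb i t - mean_velocity N y t0))\<^sup>2) = real N * (std_velocity N y t0)\<^sup>2"
proof -
  let ?w = "mean_velocity N y t0"
  have at_t0: "(\<Sum>i<N. (norm (va i t0 - ?w))\<^sup>2) = real N * (std_velocity N y t0)\<^sup>2"
    using sum_dev_mean variance_nonneg assms(1) by (simp add: std_velocity_def)
  have "(\<Sum>i<N. va i t) = (\<Sum>i<N. va i t0)"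
    using conserved[of "\<lambda>v. v" t t0] momentum_jump assms by simp
  moreover have "(\<Sum>i<N. (norm (va i t))\<^sup>2) = (\<Sum>i<N. (norm (va i t0))\<^sup>2)"
    using conserved[of "\<lambda>v. (norm v)\<^sup>2" t t0] energy_jump assms by simp
  ultimately show va: "(\<Sum>i<N. (norm (va i t - ?w))\<^sup>2) = real N * (std_velocity N y t0)\<^sup>2"
    using at_t0 unfolding sum_dev_expand by simp
  then show "(\<Sum>i<N. (norm (vb i t - ?w))\<^sup>2) = real N * (std_velocity N y t0)\<^sup>2"
    unfolding sum_dev_expand momentum_jump[OF assms(3)] energy_jump[OF assms(3)] .
qed

lemma sum_dev_le:
  assumes "N > 0" "t0 > 0" "t > 0"
  shows "(\<Sum>i<N. norm (va i t - mean_velocity N y t0)) \<le> real N * std_velocity N y t0"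
    and "(\<Sum>i<N. norm (vb i t - mean_velocity N y t0)) \<le> real N * std_velocity N y t0"
proof -
  have CS: "(\<Sum>i<N. z i) \<le> real N * s" if "(\<Sum>i<N. (z i)\<^sup>2) = real N * s\<^sup>2" "0 \<le> s" for z :: "nat \<Rightarrow> real" and s
  proof -
    \<comment> \<open>Cauchy-Schwarz against the constant vector 1.\<close>
    have "(\<Sum>i<N. 1 * z i)\<^sup>2 \<le> (\<Sum>i<N. 1\<^sup>2) * (\<Sum>i<N. (z i)\<^sup>2)"
      by (rule Cauchy_Schwarz_ineq_sum)
    then have "(\<Sum>i<N. z i)\<^sup>2 \<le> (real N * s)\<^sup>2"
      using that by (simp add: power2_eq_square mult.assoc mult.left_commute)
    then show ?thesis by (rule power2_le_imp_le) (simp add: that(2))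
  qed
  note s = std_nonneg[OF assms(1)]
  show "(\<Sum>i<N. norm (va i t - mean_velocity N y t0)) \<le> real N * std_velocity N y t0"
    "(\<Sum>i<N. norm (vb i t - mean_velocity N y t0)) \<le> real N * std_velocity N y t0"
    using CS[OF sum_dev_squared(1)[OF assms] s] CS[OF sum_dev_squared(2)[OF assms] s] .
qed

lemma length_bound:
  assumes "N > 0" "t0 > 0"
  shows "(\<Sum>t | t \<in> C \<and> t < r. \<Sum>i<N. norm (va i t - vb i t))
    \<le> 16 * real CARD('n) * (real N)\<^sup>2 * std_velocity N y t0"
proof -
  let ?w = "mean_velocity N y t0" and ?s = "std_velocity N y t0"
  have comp: "(\<Sum>t | t \<in> C \<and> t < r. \<Sum>i<N. \<bar>(va i t - vb i t) $ k\<bar>) \<le> 16 * (real N)\<^sup>2 * ?s" for k :: 'n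
  proof -
    obtain t1 t2 where t: "t1 > 0" "t2 > 0" and
      le: "(\<Sum>t | t \<in> C \<and> t < r. \<Sum>i<N. \<bar>(1 + vb i t \<bullet> 0) * (- (?w $ k) + va i t \<bullet> axis k 1) - (- (?w $ k) + vb i t \<bullet> axis k 1) * (1 + va i t \<bullet> 0)\<bar>)
        \<le> 4 * (\<Sum>i<N. \<bar>1 + vb i t1 \<bullet> 0\<bar> + \<bar>1 + va i t2 \<bullet> 0\<bar>) * (\<Sum>i<N. \<bar>- (?w $ k) + vb i t1 \<bullet> axis k 1\<bar> + \<bar>- (?w $ k) + va i t2 \<bullet> axis k 1\<bar>)"
      \<comment> \<open>The first functional is time itself, so all first components are 1 and the
        wedge is the jump of the \<open>k\<close>-th velocity component; \<open>d\<close> passes to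
        the frame of zero mean velocity.\<close>
      using planar_hodograph_bound[where r = r and c = 1 and e = 0 and d = "- (?w $ k)" and f = "axis k 1"] by blast
    have "(\<Sum>t | t \<in> C \<and> t < r. \<Sum>i<N. \<bar>(va i t - vb i t) $ k\<bar>)
        \<le> 4 * (2 * real N) * (\<Sum>i<N. \<bar>(vb i t1 - ?w) $ k\<bar> + \<bar>(va i t2 - ?w) $ k\<bar>)"
      using le by (simp add: inner_axis algebra_simps)
    also have "\<dots> \<le> 4 * (2 * real N) * (\<Sum>i<N. norm (vb i t1 - ?w) + norm (va i t2 - ?w))"
      by (intro mult_left_mono sum_mono add_mono component_le_norm_cart) auto
    also have "\<dots> \<le> 4 * (2 * real N) * (2 * (real N * ?s))"
      using sum_dev_le(2)[OF assms t(1)] sum_dev_le(1)[OF assms t(2)]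
      by (intro mult_left_mono) (auto simp: sum.distrib)
    finally show ?thesis by (simp add: power2_eq_square)
  qed
  have "(\<Sum>t | t \<in> C \<and> t < r. \<Sum>i<N. norm (va i t - vb i t))
      \<le> (\<Sum>t | t \<in> C \<and> t < r. \<Sum>i<N. \<Sum>k\<in>UNIV. \<bar>(va i t - vb i t) $ k\<bar>)"
    by (intro sum_mono norm_le_l1_cart)
  also have "\<dots> = (\<Sum>k\<in>UNIV. \<Sum>t | t \<in> C \<and> t < r. \<Sum>i<N. \<bar>(va i t - vb i t) $ k\<bar>)"
    by (simp only: sum.swap[of _ "UNIV :: 'n set"])
  also have "\<dots> \<le> (\<Sum>k\<in>(UNIV :: 'n set). 16 * (real N)\<^sup>2 * ?s)"
    by (intro sum_mono comp)
  finally show ?thesis by (simp add: algebra_simps)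
qed

lemma area_bound:
  assumes "N > 0" "t0 > 0"
  shows "(\<Sum>t | t \<in> C \<and> t < r. \<Sum>i<N.
      wedge_norm (vb i t - mean_velocity N y t0) (va i t - mean_velocity N y t0) / 2)
    \<le> 8 * (real CARD('n))\<^sup>2 * (real N)\<^sup>2 * (std_velocity N y t0)\<^sup>2"
proof -
  let ?w = "mean_velocity N y t0" and ?s = "std_velocity N y t0"
  let ?D = "\<lambda>t i k l. \<bar>(vb i t - ?w) $ k * (va i t - ?w) $ l - (vb i t - ?w) $ l * (va i t - ?w) $ k\<bar>"
  have comp: "(\<Sum>t | t \<in> C \<and> t < r. \<Sum>i<N. ?D t i k l) \<le> 16 * (real N)\<^sup>2 * ?s\<^sup>2" for k l :: 'n
  proof -
    have shift: "- (?w $ k) + v \<bullet> axis k 1 = (v - ?w) $ k" for v k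
      by (simp add: inner_axis)
    obtain t1 t2 where t: "t1 > 0" "t2 > 0" and
      le: "(\<Sum>t | t \<in> C \<and> t < r. \<Sum>i<N. ?D t i k l)
        \<le> 4 * (\<Sum>i<N. \<bar>(vb i t1 - ?w) $ k\<bar> + \<bar>(va i t2 - ?w) $ k\<bar>) * (\<Sum>i<N. \<bar>(vb i t1 - ?w) $ l\<bar> + \<bar>(va i t2 - ?w) $ l\<bar>)"
      \<comment> \<open>Two spatial axes in the frame of zero mean velocity, so both factors are
        controlled by the standard deviation.\<close>
      using planar_hodograph_bound[where r = r and c = "- (?w $ k)" and e = "axis k 1" and d = "- (?w $ l)" and f = "axis l 1"]
      unfolding shift by blast
    have dev: "(\<Sum>i<N. \<bar>(vb i t1 - ?w) $ k\<bar> + \<bar>(va i t2 - ?w) $ k\<bar>) \<le> 2 * (real N * ?s)" for k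
    proof -
      have "(\<Sum>i<N. \<bar>(vb i t1 - ?w) $ k\<bar> + \<bar>(va i t2 - ?w) $ k\<bar>) \<le> (\<Sum>i<N. norm (vb i t1 - ?w) + norm (va i t2 - ?w))"
        by (intro sum_mono add_mono component_le_norm_cart)
      then show ?thesis
        using sum_dev_le(2)[OF assms t(1)] sum_dev_le(1)[OF assms t(2)] by (simp add: sum.distrib)
    qed
    have "(\<Sum>i<N. \<bar>(vb i t1 - ?w) $ k\<bar> + \<bar>(va i t2 - ?w) $ k\<bar>) * (\<Sum>i<N. \<bar>(vb i t1 - ?w) $ l\<bar> + \<bar>(va i t2 - ?w) $ l\<bar>)
        \<le> (2 * (real N * ?s)) * (2 * (real N * ?s))"
      using std_nonneg[OF assms(1)] by (intro mult_mono dev sum_nonneg) auto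
    then show ?thesis using le by (simp add: power2_eq_square algebra_simps)
  qed
  have "(\<Sum>t | t \<in> C \<and> t < r. \<Sum>i<N. wedge_norm (vb i t - ?w) (va i t - ?w))
      \<le> (\<Sum>t | t \<in> C \<and> t < r. \<Sum>i<N. \<Sum>k\<in>UNIV. \<Sum>l\<in>UNIV. ?D t i k l)"
    by (intro sum_mono wedge_norm_le)
  also have "\<dots> = (\<Sum>t | t \<in> C \<and> t < r. \<Sum>k\<in>UNIV. \<Sum>l\<in>UNIV. \<Sum>i<N. ?D t i k l)"
    by (simp only: sum.swap[of _ _ "{..<N}"])
  also have "\<dots> = (\<Sum>k\<in>UNIV. \<Sum>l\<in>UNIV. \<Sum>t | t \<in> C \<and> t < r. \<Sum>i<N. ?D t i k l)"
    by (simp only: sum.swap[of _ _ "{t \<in> C. t < r}"])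
  also have "\<dots> \<le> (\<Sum>k\<in>(UNIV :: 'n set). \<Sum>l\<in>(UNIV :: 'n set). 16 * (real N)\<^sup>2 * ?s\<^sup>2)"
    by (intro sum_mono comp)
  finally show ?thesis by (simp add: sum_divide_distrib[symmetric] power2_eq_square algebra_simps)
qed

text \<open>Every finite set of collision times lies below some \<open>r\<close>, so the uniform
  bound on truncated sums bounds the infinite one. All particles can share the index set
  \<open>C\<close> because a term vanishes where its particle does not jump.\<close>

lemma infsum_bound:
  fixes g :: "nat \<Rightarrow> real \<Rightarrow> real"
  assumes nonneg: "\<And>i t. 0 \<le> g i t"
    and zero: "\<And>i t. i < N \<Longrightarrow> t > 0 \<Longrightarrow> va i t = vb i t \<Longrightarrow> g i t = 0"
    and bound: "\<And>r. (\<Sum>t | t \<in> C \<and> t < r. \<Sum>i<N. g i t) \<le> B"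
  shows "(\<Sum>i<N. \<Sum>\<^sub>\<infinity>t\<in>collision_times N a y i. ennreal (g i t)) \<le> ennreal B"
proof -
  have "(\<Sum>i<N. \<Sum>\<^sub>\<infinity>t\<in>collision_times N a y i. ennreal (g i t)) = (\<Sum>i<N. \<Sum>\<^sub>\<infinity>t\<in>C. ennreal (g i t))"
  proof (intro sum.cong refl infsum_cong_neutral)
    fix i t assume i: "i \<in> {..<N}"
    show "ennreal (g i t) = 0" if "t \<in> C - collision_times N a y i"
    proof -
      have "t > 0" using that by (auto simp: C_def collision_times_def)
      then show ?thesis using that zero no_jump i by simp
    qed
    show "ennreal (g i t) = 0" if "t \<in> collision_times N a y i - C"
      using that i by (auto simp: C_def)
  qed
  also have "\<dots> = (\<Sum>\<^sub>\<infinity>t\<in>C. \<Sum>i<N. ennreal (g i t))"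
    by (rule sum_infsum_ennreal)
  also have "\<dots> \<le> ennreal B"
  proof (rule infsum_le_finite_sums)
    show "(\<lambda>t. \<Sum>i<N. ennreal (g i t)) summable_on C"
      by (rule nonneg_summable_on_complete) simp
    fix F assume F: "finite F" "F \<subseteq> C"
    define r where "r = Max F + 1"
    have r: "t < r" if "t \<in> F" for t
      using Max_ge[OF F(1) that] by (simp add: r_def)
    have "(\<Sum>t\<in>F. \<Sum>i<N. g i t) \<le> (\<Sum>t | t \<in> C \<and> t < r. \<Sum>i<N. g i t)"
      using F r nonneg by (intro sum_mono2 finite_C sum_nonneg) auto
    then have "(\<Sum>t\<in>F. \<Sum>i<N. g i t) \<le> B" using bound[of r] by linarith
    then show "(\<Sum>t\<in>F. \<Sum>i<N. ennreal (g i t)) \<le> ennreal B"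
      using nonneg by (simp add: sum_ennreal sum_nonneg ennreal_leI)
  qed
  finally show ?thesis .
qed

end

theorem mainTheorem2:
  "\<exists>c::real. c \<ge> 0 \<and>
     (\<forall>(N::nat) (a::real) (y :: nat \<Rightarrow> real \<Rightarrow> real ^ 'n::finite) (t\<^sub>0::real).
        N > 0 \<longrightarrow> a > 0 \<longrightarrow> t\<^sub>0 > 0 \<longrightarrow>
        hard_sphere_motion N a y \<longrightarrow>
        locally_finite_collisions N a y \<longrightarrow>
        only_binary_collisions N a y \<longrightarrow>
        (\<Sum>\<alpha><N. hodograph_length N a y \<alpha>)
          \<le> ennreal (c * (real N)\<^sup>2 * std_velocity N y t\<^sub>0) \<and>
        (\<Sum>\<alpha><N. hodograph_area N a y (mean_velocity N y t\<^sub>0) \<alpha>)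
          \<le> ennreal (c * (real N)\<^sup>2 * std_velocity N y t\<^sub>0 * rms_velocity N y t\<^sub>0))"
proof (intro exI[of _ "16 * (real CARD('n))\<^sup>2"] conjI allI impI)
  fix N :: nat and a :: real and y :: "nat \<Rightarrow> real \<Rightarrow> real ^ 'n" and t0 :: real
  assume N: "N > 0" and "a > 0" and t0: "t0 > 0" and "hard_sphere_motion N a y"
    "locally_finite_collisions N a y" "only_binary_collisions N a y"
  then interpret binary_motion N a y by unfold_locales
  \<comment> \<open>One constant serves both estimates: the length needs \<open>16 * n\<close> and
    the area \<open>8 * n\<^sup>2\<close>, with \<open>n\<close> the dimension.\<close>
  let ?c = "16 * (real CARD('n))\<^sup>2" and ?w = "mean_velocity N y t0" and ?s = "std_velocity N y t0"
  note s = std_nonneg[OF N]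
  have n: "1 \<le> real CARD('n)" by (simp add: Suc_leI)
  show "(\<Sum>\<alpha><N. hodograph_length N a y \<alpha>) \<le> ennreal (?c * (real N)\<^sup>2 * ?s)"
    unfolding hodograph_length_def
  proof (rule infsum_bound)
    have "real CARD('n) \<le> (real CARD('n))\<^sup>2"
      using n by (intro self_le_power) auto
    then have "16 * real CARD('n) * (real N)\<^sup>2 * ?s \<le> ?c * (real N)\<^sup>2 * ?s"
      using s by (intro mult_right_mono mult_left_mono) auto
    then show "(\<Sum>t | t \<in> C \<and> t < r. \<Sum>i<N. norm (va i t - vb i t)) \<le> ?c * (real N)\<^sup>2 * ?s" for r
      using length_bound[OF N t0, of r] by linarith
  qed auto
  show "(\<Sum>\<alpha><N. hodograph_area N a y ?w \<alpha>) \<le> ennreal (?c * (real N)\<^sup>2 * ?s * rms_velocity N y t0)"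
    unfolding hodograph_area_def
  proof (rule infsum_bound)
    \<comment> \<open>The area estimate has the square of the standard deviation; one factor is
      weakened to the root mean square velocity.\<close>
    have "?s \<le> sqrt ((rms_velocity N y t0)\<^sup>2)"
      unfolding std_velocity_def by (intro real_sqrt_le_mono) simp
    also have "\<dots> = rms_velocity N y t0"
      by (simp add: rms_velocity_def energy_def sum_nonneg)
    finally have "8 * ?s * ?s \<le> 16 * ?s * rms_velocity N y t0"
      using s by (intro mult_mono) auto
    then have "(8 * ?s * ?s) * ((real CARD('n))\<^sup>2 * (real N)\<^sup>2) \<le> (16 * ?s * rms_velocity N y t0) * ((real CARD('n))\<^sup>2 * (real N)\<^sup>2)"
      by (intro mult_right_mono) auto
    then show "(\<Sum>t | t \<in> C \<and> t < r. \<Sum>i<N. wedge_norm (vb i t - ?w) (va i t - ?w) / 2)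
        \<le> ?c * (real N)\<^sup>2 * ?s * rms_velocity N y t0" for r
      using area_bound[OF N t0, of r] by (simp add: power2_eq_square algebra_simps)
    show "0 \<le> wedge_norm (vb i t - ?w) (va i t - ?w) / 2" for i t
      using Cauchy_Schwarz_ineq[of "vb i t - ?w" "va i t - ?w"]
      by (simp add: wedge_norm_def power2_norm_eq_inner)
    show "wedge_norm (vb i t - ?w) (va i t - ?w) / 2 = 0" if "va i t = vb i t" for i t
      unfolding that wedge_norm_def power2_norm_eq_inner by (simp add: power2_eq_square)
  qed
qed simp

end
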